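(* Let $(\Omega,\Sigma,\mu)$ be a $\sigma$-finite measure space, $\mathcal{A}\subseteq\Sigma$ a $\sigma$-subalgebra such that $(\Omega,\mathcal{A},\mu)$ is $\sigma$-finite, $E=E^{\mathcal{A}}$ the conditional expectation, and write $\Omega=\left(\bigcup_{n\in\mathbb{N}}A_n\right)\cup B$ where $\{A_n\}_{n\in\mathbb N}$ is a countable collection of pairwise disjoint $\mathcal{A}$-atoms and $B\in\mathcal{A}$, disjoint from each $A_n$, is non-atomic (with respect to $\mathcal{A}$). Let $\Phi,\Psi$ be Young's functions, $u$ a $\Sigma$-measurable function on $\Omega$, and let the WCT operator $R_u:\mathcal{D}\subseteq L^{\Phi}(\Sigma)\to L^{\Psi}(\Sigma)$, $R_u(f)=E(uf)$, be well defined on a linear subspace $\mathcal{D}$. Then the following hold. (a) Let $\Phi^{*}\circ(\Psi^{*})^{-1}\preceq\Theta$ globally for some Young's function $\Theta$. If $\Phi^{*}\in\bigtriangleup'$ globally, $\Theta\in\bigtriangledown'$ globally, and (i) $E(\Phi^{*}(\bar u))=0$ on $B$, (ii) $\displaystyle\sup_{n\in\mathbb{N}}\frac{E(\Phi^{*}(\bar u))(A_n)\,\mu(A_n)}{\Phi^{*}((\Psi^{*})^{-1}(\mu(A_n)))}<\infty$, then $R_u$ is bounded. In another case, if $\Phi^{*}\in\bigtriangleup'$ globally and $(\Psi^{*})^{-1}\in\bigtriangleup'$ globally, $$\sup_{n\in\mathbb{N}}E(\Phi^{*}(\bar u))(A_n)\,\mu(A_n)\,\Phi^{*}\!\left((\Psi^{*})^{-1}\!\left(\tfrac{1}{\mu(A_n)}\right)\right)<\infty,$$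 and (i) holds, then $R_u$ is bounded. (b) If $\Phi^{*}\circ(\Psi^{*})^{-1}$ is a Young's function, $\Phi^{*}\in\bigtriangledown'$ globally, and $R_u$ is bounded from $L^{\Phi}(\Sigma)$ into $L^{\Psi}(\Sigma)$, then (i) $E(\Phi^{*}(\bar u))=0$ on $B$, (ii) $\displaystyle\sup_{n\in\mathbb{N}}E(\Phi^{*}(\bar u))(A_n)\,\mu(A_n)\,\Phi^{*}\!\left((\Psi^{*})^{-1}\!\left(\tfrac{1}{\mu(A_n)}\right)\right)<\infty$.
   Context: A Young's function is a continuous convex even function $\Phi:\mathbb{R}\to\mathbb{R}$ with $\Phi(x)=0$ iff $x=0$, $\lim_{x\to\infty}\Phi(x)=\infty$ and $\lim_{x\to\infty}\Phi(x)/x=\infty$. Its complementary function is $\Phi^{*}(y)=\sup\{x|y|-\Phi(x):x\ge 0\}$; it is taken to have the same properties, so that $\Phi$ and $\Phi^{*}$ are strictly increasing on $[0,\infty)$ with inverses $\Phi^{-1},(\Phi^{*})^{-1}:[0,\infty)\to[0,\infty)$. For a complex-valued function $f$, $\Phi(f)$ means $\Phi(|f|)$; $\bar u$ is the complex conjugate of $u$. Functions such as $\Phi^{*}\circ(\Psi^{*})^{-1}$ are functions on $[0,\infty)$ and are called Young's functions if their even extensions to $\mathbb{R}$ are. For functions $F,G$ on $[0,\infty)$: $F\preceq G$ globally means there is $a\ge0$ with $F(x)\le G(ax)$ for all $x\ge 0$. $F\in\bigtriangleup'$ globally means there is $c>0$ with $F(xy)\le cF(x)F(y)$ for all $x,y\ge0$.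 $F\in\bigtriangledown'$ globally means there is $b>0$ with $F(bxy)\ge F(x)F(y)$ for all $x,y\ge0$. $L^{\Phi}(\Sigma)$ is the Orlicz space of $\Sigma$-measurable $f:\Omega\to\mathbb{C}$ with $\int_\Omega\Phi(k|f|)\,d\mu<\infty$ for some $k>0$, with norm $N_\Phi(f)=\inf\{k>0:\int_\Omega\Phi(f/k)\,d\mu\le 1\}$. $E(f)=E^{\mathcal{A}}(f)$ is the a.e. unique $\mathcal{A}$-measurable function with $\int_A f\,d\mu=\int_A E(f)\,d\mu$ for $A\in\mathcal{A}$, defined for nonnegative measurable $f$ and extended by linearity to $f$ with $E(|f|)<\infty$ a.e.; $f$ is conditionable if $E(f)$ is defined. An $\mathcal{A}$-atom is $A\in\mathcal{A}$ with $\mu(A)>0$ such that each $F\in\mathcal{A}$, $F\subseteq A$, has $\mu(F)=0$ or $\mu(F)=\mu(A)$. An $\mathcal{A}$-measurable function $g$ is a.e. constant on an $\mathcal{A}$-atom $A_n$, and $g(A_n)$ denotes this constant. The WCT operator $R_u:\mathcal{D}\to L^{\Psi}(\Sigma)$, $R_u(f)=E(uf)$, is well defined on the linear subspace $\mathcal{D}\subseteq L^\Phi(\Sigma)$ if for all $f\in\mathcal{D}$, $uf$ is conditionable and $E(uf)\in L^{\Psi}(\Sigma)$. It is bounded if there is $K$ with $N_\Psi(R_uf)\le K N_\Phi(f)$ for all $f$ in its domain; "bounded from $L^\Phi(\Sigma)$ into $L^\Psi(\Sigma)$" means well defined on all of $L^\Phi(\Sigma)$ and bounded. *)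

theory Defs
  imports "HOL-Probability.Probability"
begin

section \<open>Young's functions\<close>

definition young_function :: "(real \<Rightarrow> real) \<Rightarrow> bool" where
  "young_function \<Phi> \<longleftrightarrow>
     continuous_on UNIV \<Phi> \<and> convex_on UNIV \<Phi> \<and> (\<forall>x. \<Phi> (- x) = \<Phi> x) \<and>
     (\<forall>x. \<Phi> x = 0 \<longleftrightarrow> x = 0) \<and>
     filterlim \<Phi> at_top at_top \<and> filterlim (\<lambda>x. \<Phi> x / x) at_top at_top"

text \<open>The real supremum is that of a nonempty set which, for a Young's function, is bounded
  above because \<open>\<Phi> x / x\<close> tends to infinity.\<close>

definition complementary :: "(real \<Rightarrow> real) \<Rightarrow> real \<Rightarrow> real" where
  "complementary \<Phi> y = (SUP x\<in>{0..}. x * \<bar>y\<bar> - \<Phi> x)"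

text \<open>In the following definitions a function on the half-line is represented by a function on
  the reals of which only the values at nonnegative arguments matter.\<close>

definition half_inv :: "(real \<Rightarrow> real) \<Rightarrow> real \<Rightarrow> real" where
  "half_inv \<Phi> = inv_into {0..} \<Phi>"

definition even_extension :: "(real \<Rightarrow> real) \<Rightarrow> real \<Rightarrow> real" where
  "even_extension f = (\<lambda>x. f \<bar>x\<bar>)"

definition dominated_globally :: "(real \<Rightarrow> real) \<Rightarrow> (real \<Rightarrow> real) \<Rightarrow> bool" where
  "dominated_globally f g \<longleftrightarrow> (\<exists>a\<ge>0. \<forall>x\<ge>0. f x \<le> g (a * x))"

definition delta_prime :: "(real \<Rightarrow> real) \<Rightarrow> bool" where
  "delta_prime f \<longleftrightarrow> (\<exists>c>0. \<forall>x\<ge>0. \<forall>y\<ge>0. f (x * y) \<le> c * f x * f y)"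

definition nabla_prime :: "(real \<Rightarrow> real) \<Rightarrow> bool" where
  "nabla_prime f \<longleftrightarrow> (\<exists>b>0. \<forall>x\<ge>0. \<forall>y\<ge>0. f (b * x * y) \<ge> f x * f y)"

section \<open>Orlicz spaces\<close>

text \<open>Elements are functions rather than classes modulo equality almost everywhere.\<close>

definition orlicz_space :: "'a measure \<Rightarrow> (real \<Rightarrow> real) \<Rightarrow> ('a \<Rightarrow> complex) set" where
  "orlicz_space M \<Phi> =
     {f \<in> borel_measurable M. \<exists>k>0. (\<integral>\<^sup>+x. ennreal (\<Phi> (k * cmod (f x))) \<partial>M) < \<infinity>}"

text \<open>Meaningful only on the Orlicz space, where the infimum is over a nonempty set.\<close>

definition orlicz_norm :: "'a measure \<Rightarrow> (real \<Rightarrow> real) \<Rightarrow> ('a \<Rightarrow> complex) \<Rightarrow> real" where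
  "orlicz_norm M \<Phi> f =
     Inf {k. k > 0 \<and> (\<integral>\<^sup>+x. ennreal (\<Phi> (cmod (f x / of_real k))) \<partial>M) \<le> 1}"

definition function_subspace :: "('a \<Rightarrow> complex) set \<Rightarrow> bool" where
  "function_subspace D \<longleftrightarrow>
     (\<lambda>x. 0) \<in> D \<and>
     (\<forall>f\<in>D. \<forall>g\<in>D. (\<lambda>x. f x + g x) \<in> D) \<and>
     (\<forall>c. \<forall>f\<in>D. (\<lambda>x. c * f x) \<in> D)"

section \<open>Conditional expectation of complex functions\<close>

text \<open>Throughout, the second measure argument carries the sub-\<open>\<sigma>\<close>-algebra: only its
  measurable sets are used, the measure being that of \<open>M\<close>.\<close>

definition conditionable :: "'a measure \<Rightarrow> 'a measure \<Rightarrow> ('a \<Rightarrow> complex) \<Rightarrow> bool" where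
  "conditionable M \<A> f \<longleftrightarrow>
     f \<in> borel_measurable M \<and> (AE x in M. nn_cond_exp M \<A> (\<lambda>x. ennreal (cmod (f x))) x < \<infinity>)"

text \<open>\<open>real_cond_exp\<close> is the difference of the \<open>nn_cond_exp\<close> of the positive and negative
  parts, so for a conditionable function this is the extension by linearity from nonnegative
  functions; no integrability is required.\<close>

definition complex_cond_exp ::
    "'a measure \<Rightarrow> 'a measure \<Rightarrow> ('a \<Rightarrow> complex) \<Rightarrow> 'a \<Rightarrow> complex" where
  "complex_cond_exp M \<A> f = (\<lambda>x. Complex (real_cond_exp M \<A> (\<lambda>x. Re (f x)) x)
                                        (real_cond_exp M \<A> (\<lambda>x. Im (f x)) x))"

section \<open>Atoms\<close>

definition subalg_atom :: "'a measure \<Rightarrow> 'a measure \<Rightarrow> 'a set \<Rightarrow> bool" where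
  "subalg_atom M \<A> A \<longleftrightarrow>
     A \<in> sets \<A> \<and> emeasure M A > 0 \<and>
     (\<forall>S\<in>sets \<A>. S \<subseteq> A \<longrightarrow> emeasure M S = 0 \<or> emeasure M S = emeasure M A)"

definition subalg_nonatomic :: "'a measure \<Rightarrow> 'a measure \<Rightarrow> 'a set \<Rightarrow> bool" where
  "subalg_nonatomic M \<A> B \<longleftrightarrow> B \<in> sets \<A> \<and> (\<forall>A. A \<subseteq> B \<longrightarrow> \<not> subalg_atom M \<A> A)"

text \<open>The index set \<open>I\<close> allows for finitely many, or no, atoms.\<close>

definition atomic_decomposition ::
    "'a measure \<Rightarrow> 'a measure \<Rightarrow> nat set \<Rightarrow> (nat \<Rightarrow> 'a set) \<Rightarrow> 'a set \<Rightarrow> bool" where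
  "atomic_decomposition M \<A> I A B \<longleftrightarrow>
     (\<forall>n\<in>I. subalg_atom M \<A> (A n)) \<and> disjoint_family_on A I \<and>
     subalg_nonatomic M \<A> B \<and> (\<forall>n\<in>I. A n \<inter> B = {}) \<and>
     space M = (\<Union>n\<in>I. A n) \<union> B"

text \<open>The almost everywhere constant value of \<open>g\<close> on the atom \<open>A\<close>.\<close>

definition atom_value :: "'a measure \<Rightarrow> ('a \<Rightarrow> 'b) \<Rightarrow> 'a set \<Rightarrow> 'b" where
  "atom_value M g A = (THE c. AE x in M. x \<in> A \<longrightarrow> g x = c)"

section \<open>Weighted conditional type operators\<close>

definition wct ::
    "'a measure \<Rightarrow> 'a measure \<Rightarrow> ('a \<Rightarrow> complex) \<Rightarrow> ('a \<Rightarrow> complex) \<Rightarrow> 'a \<Rightarrow> complex" where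
  "wct M \<A> u f = complex_cond_exp M \<A> (\<lambda>x. u x * f x)"

definition wct_well_defined ::
    "'a measure \<Rightarrow> 'a measure \<Rightarrow> (real \<Rightarrow> real) \<Rightarrow> ('a \<Rightarrow> complex) \<Rightarrow> ('a \<Rightarrow> complex) set \<Rightarrow> bool" where
  "wct_well_defined M \<A> \<Psi> u D \<longleftrightarrow>
     (\<forall>f\<in>D. conditionable M \<A> (\<lambda>x. u x * f x) \<and> wct M \<A> u f \<in> orlicz_space M \<Psi>)"

definition wct_bounded ::
    "'a measure \<Rightarrow> 'a measure \<Rightarrow> (real \<Rightarrow> real) \<Rightarrow> (real \<Rightarrow> real) \<Rightarrow> ('a \<Rightarrow> complex) \<Rightarrow>
     ('a \<Rightarrow> complex) set \<Rightarrow> bool" where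
  "wct_bounded M \<A> \<Phi> \<Psi> u D \<longleftrightarrow>
     (\<exists>K. \<forall>f\<in>D. orlicz_norm M \<Psi> (wct M \<A> u f) \<le> K * orlicz_norm M \<Phi> f)"

text \<open>The \<open>[0,\<infinity>]\<close>-valued function \<open>E(\<Phi>(f))\<close>.\<close>

definition cond_modular ::
    "'a measure \<Rightarrow> 'a measure \<Rightarrow> (real \<Rightarrow> real) \<Rightarrow> ('a \<Rightarrow> complex) \<Rightarrow> 'a \<Rightarrow> ennreal" where
  "cond_modular M \<A> \<Phi> f = nn_cond_exp M \<A> (\<lambda>x. ennreal (\<Phi> (cmod (f x))))"

end

(*
Write phi, psi for the complementary functions of Phi, Psi and theta = phi o psi^{-1}.

(a) On B the weight u vanishes, so everything happens on the atoms. For values g_n \<ge> 0 with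
sum psi(g_n) mu(A_n) \<le> 1, the growth conditions bound sum E(phi(u))(A_n) mu(A_n) phi(g_n) by a
constant times sum Theta(a t_n), where t_n = psi(g_n) mu(A_n) \<in> [0,1] have sum at most 1; this is
at most Theta(a) by convexity. Young's inequality turns it into a bound for
sum g_n mu(A_n) |E(uf)|(A_n) with f in the unit ball of L^Phi. Choosing g_n as the slope of Psi at the
n-th value of |E(uf)|/L gives equality in Young's inequality, and hence the modular bound for E(uf)/L.

(b) Dually, testing the operator on f = phi'(v) times the conjugate phase of u, with
v = psi^{-1}(1/mu(S)) |u| / (4K) on S, yields that the modular of v over S is at most 1 for every
S in the subalgebra of finite positive measure. Supermultiplicativity of phi separates this into
(int_S phi(|u|)) theta(1/mu(S)) \<le> C. Taking atoms gives (ii); shrinking S inside B gives (i), because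
theta(x)/x tends to infinity.
*)
theory Submission
  imports Defs
begin

section \<open>Young's functions\<close>

text \<open>Both parts rest on one absorption argument. The test function is built so that Young's
  inequality is an equality at every point; with U the modular to be bounded and T the modular of
  the test function, the pairing is then a constant multiple of U + T. No bound on T is known in
  advance, but the hypothesis, applied after normalising by max 1 T, bounds the same pairing by that
  constant times max 1 T. So U + T is at most max 1 T, which forces U to be at most 1. The
  cancellation needs T to be finite: part (a) works with finitely many atoms, part (b) with the set
  where |u| is at most N, and monotone convergence removes either restriction. The factor 4 in part
  (a) is a 2 from splitting a complex conditional expectation into real and imaginary parts times a
  2 from Hoelder's inequality with modulars in place of dual norms. In part (b) the first 2 is
  replaced by one that makes a norm inequality strict, so that it yields a modular inequality
  whether or not the infimum in the norm is attained.\<close>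

context
  fixes \<Phi> :: "real \<Rightarrow> real"
  assumes \<Phi>: "young_function \<Phi>"
begin

lemma young_continuous: "continuous_on S \<Phi>"
  using \<Phi> continuous_on_subset unfolding young_function_def by blast

lemma young_convex: "convex_on UNIV \<Phi>"
  using \<Phi> unfolding young_function_def by blast

lemma young_even: "\<Phi> (- x) = \<Phi> x"
  using \<Phi> unfolding young_function_def by blast

lemma young_eq_0_iff: "\<Phi> x = 0 \<longleftrightarrow> x = 0"
  using \<Phi> unfolding young_function_def by blast

lemma young_zero: "\<Phi> 0 = 0"
  by (simp add: young_eq_0_iff)

lemma young_measurable: "\<Phi> \<in> borel_measurable borel"
  by (intro borel_measurable_continuous_onI young_continuous)

lemma young_scale:
  assumes "0 \<le> t" "t \<le> 1" shows "\<Phi> (t * x) \<le> t * \<Phi> x"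
  using convex_onD[OF young_convex assms, of 0 x] by (simp add: young_zero)

text \<open>The origin is the midpoint of \<open>x\<close> and \<open>- x\<close>, where evenness
  gives equal values.\<close>

lemma young_nonneg: "0 \<le> \<Phi> x"
  using convex_onD[OF young_convex, of "1/2" x "- x"] young_even[of x] by (simp add: young_zero)

lemma young_pos: "x \<noteq> 0 \<Longrightarrow> 0 < \<Phi> x"
  using young_nonneg[of x] young_eq_0_iff[of x] by linarith

lemma young_divide:
  assumes "1 \<le> t" shows "\<Phi> (x / t) \<le> \<Phi> x / t"
  using young_scale[of "1 / t" x] assms by simp

lemma young_strict_mono:
  assumes "0 \<le> x" "x < y" shows "\<Phi> x < \<Phi> y"
proof -
  have "\<Phi> x \<le> (x / y) * \<Phi> y"
    using young_scale[of "x / y" y] assms by simp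
  also have "\<dots> < 1 * \<Phi> y"
    using assms by (intro mult_strict_right_mono young_pos) auto
  finally show ?thesis by simp
qed

lemma young_mono:
  assumes "0 \<le> x" "x \<le> y" shows "\<Phi> x \<le> \<Phi> y"
  using young_strict_mono[of x y] assms by (cases "x = y") auto

section \<open>Inverses on the half-line\<close>

lemma young_surj:
  assumes "0 \<le> y" shows "\<exists>x\<ge>0. \<Phi> x = y"
proof -
  have "filterlim \<Phi> at_top at_top"
    using \<Phi> unfolding young_function_def by blast
  then obtain N where N: "\<And>x. x \<ge> N \<Longrightarrow> y \<le> \<Phi> x"
    unfolding filterlim_at_top eventually_at_top_linorder by metis
  have "\<exists>x. 0 \<le> x \<and> x \<le> max 0 N \<and> \<Phi> x = y"
    using N[of "max 0 N"] assms by (intro IVT' young_continuous) (auto simp: young_zero)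
  then show ?thesis by blast
qed

lemma half_inv_props:
  assumes "0 \<le> y" shows half_inv_nonneg: "0 \<le> half_inv \<Phi> y" and half_inv_right: "\<Phi> (half_inv \<Phi> y) = y"
proof -
  have "y \<in> \<Phi> ` {0..}" using young_surj[OF assms] by auto
  then show "0 \<le> half_inv \<Phi> y" "\<Phi> (half_inv \<Phi> y) = y"
    unfolding half_inv_def using inv_into_into[of y \<Phi> "{0..}"] by (auto intro: f_inv_into_f)
qed

lemma half_inv_left:
  assumes "0 \<le> x" shows "half_inv \<Phi> (\<Phi> x) = x"
proof -
  have "inj_on \<Phi> {0..}"
    by (rule linorder_inj_onI) (use young_strict_mono in \<open>force+\<close>)
  then show ?thesis unfolding half_inv_def using assms by simp
qed

lemma half_inv_pos: "0 < y \<Longrightarrow> 0 < half_inv \<Phi> y"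
  using half_inv_nonneg[of y] half_inv_right[of y] young_eq_0_iff[of "half_inv \<Phi> y"]
  by (cases "half_inv \<Phi> y = 0") auto

text \<open>The growth of \<open>\<Phi> x / x\<close> in a form free of division. It confines the
  search for a maximum to a compact interval below, and later contradicts a bound on sets of very
  small measure.\<close>

lemma young_superlinear: "\<exists>R>0. \<forall>x\<ge>R. c * x \<le> \<Phi> x"
proof -
  have "filterlim (\<lambda>x. \<Phi> x / x) at_top at_top"
    using \<Phi> unfolding young_function_def by blast
  then obtain N where N: "\<And>x. x \<ge> N \<Longrightarrow> c \<le> \<Phi> x / x"
    unfolding filterlim_at_top eventually_at_top_linorder by metis
  show ?thesis
    proof (intro exI[of _ "max 1 N"] conjI allI impI)
    fix x assume "max 1 N \<le> x"
    then show "c * x \<le> \<Phi> x" using N[of x] by (simp add: field_simps)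
  qed simp
qed

text \<open>Beyond \<open>R\<close> the objective is at most 0, its value at the origin, so a
  maximum over the compact interval from 0 to \<open>R\<close> is global. The last conclusion is
  equality in Young's inequality for a prescribed \<open>y\<close>.\<close>

lemma complementary_attained:
  obtains x where "0 \<le> x" "\<And>z. 0 \<le> z \<Longrightarrow> z * \<bar>y\<bar> - \<Phi> z \<le> x * \<bar>y\<bar> - \<Phi> x"
    "x * \<bar>y\<bar> = \<Phi> x + complementary \<Phi> y"
proof -
  obtain R where R: "0 < R" "\<And>x. R \<le> x \<Longrightarrow> \<bar>y\<bar> * x \<le> \<Phi> x"
    using young_superlinear by blast
  have "continuous_on {0..R} (\<lambda>x. x * \<bar>y\<bar> - \<Phi> x)"
    by (intro continuous_intros young_continuous)
  then obtain x where x: "x \<in> {0..R}" "\<And>z. z \<in> {0..R} \<Longrightarrow> z * \<bar>y\<bar> - \<Phi> z \<le> x * \<bar>y\<bar> - \<Phi> x"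
    using continuous_attains_sup[of "{0..R}"] R by force
  have le: "z * \<bar>y\<bar> - \<Phi> z \<le> x * \<bar>y\<bar> - \<Phi> x" if "0 \<le> z" for z
  proof (cases "z \<le> R")
    case False
    then have "z * \<bar>y\<bar> - \<Phi> z \<le> 0" using R(2)[of z] by (simp add: mult.commute)
    also have "0 \<le> x * \<bar>y\<bar> - \<Phi> x" using x(2)[of 0] R(1) by (simp add: young_zero)
    finally show ?thesis .
  qed (use x(2) that in auto)
  have "complementary \<Phi> y = x * \<bar>y\<bar> - \<Phi> x"
    unfolding complementary_def using x le by (intro cSup_eq_maximum) auto
  then show thesis by (intro that[of x]) (use x le in simp_all)
qed

lemma young_inequality:
  assumes "0 \<le> x" "0 \<le> y" shows "x * y \<le> \<Phi> x + complementary \<Phi> y"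
proof -
  obtain x0 where "\<And>z. 0 \<le> z \<Longrightarrow> z * \<bar>y\<bar> - \<Phi> z \<le> x0 * \<bar>y\<bar> - \<Phi> x0"
    "x0 * \<bar>y\<bar> = \<Phi> x0 + complementary \<Phi> y"
    by (rule complementary_attained[of y]) blast
  then show ?thesis using assms by force
qed

text \<open>Equality in Young's inequality for a prescribed \<open>x\<close>: if \<open>y\<close> is
  the slope of a line supporting \<open>\<Phi>\<close> at \<open>x\<close>, then \<open>x\<close>
  maximises the expression that defines \<open>complementary \<Phi> y\<close>.\<close>

lemma complementary_subgradient:
  assumes "0 \<le> x" shows "\<exists>y\<ge>0. x * y = \<Phi> x + complementary \<Phi> y"
proof (cases "x = 0")
  case True
  have "complementary \<Phi> 0 = 0"
    unfolding complementary_def using young_nonneg by (intro cSup_eq_maximum) (auto simp: young_zero intro!: image_eqI[of _ _ 0])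
  then show ?thesis using True by (auto simp: young_zero intro!: exI[of _ 0])
next
  case False
  \<comment> \<open>The infimum of the difference quotients to the right of \<open>x\<close> is the
    right derivative of \<open>\<Phi>\<close> at \<open>x\<close>.\<close>
  define y where "y = Inf ((\<lambda>t. (\<Phi> x - \<Phi> t) / (x - t)) ` ({x<..} \<inter> UNIV))"
  have line: "\<Phi> z \<ge> \<Phi> x + y * (z - x)" for z
    unfolding y_def by (rule convex_le_Inf_differential[OF young_convex]) auto
  \<comment> \<open>The supporting line lies at or below \<open>\<Phi> 0 = 0\<close> at the origin,
    so the slope is positive.\<close>
  have "0 < y * x" using line[of 0] young_pos[OF False] by (simp add: young_zero)
  then have y: "0 \<le> y" using assms zero_less_mult_pos2[of y x] False by auto
  have "complementary \<Phi> y = x * \<bar>y\<bar> - \<Phi> x"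
    unfolding complementary_def using assms y line
    by (intro cSup_eq_maximum) (auto simp: algebra_simps)
  then show ?thesis using y by auto
qed

end

section \<open>Modulars and norms\<close>

text \<open>Dividing the argument by \<open>t \<ge> 1\<close> divides the modular by at least
  \<open>t\<close>, by convexity, so any finite modular can be brought down to 1. This makes the
  infimum in \<open>orlicz_norm\<close> range over a nonempty set.\<close>

lemma orlicz_modular_le_1:
  assumes "young_function \<Phi>" "f \<in> orlicz_space M \<Phi>"
  obtains k where "0 < k" "(\<integral>\<^sup>+x. ennreal (\<Phi> (cmod (f x) / k)) \<partial>M) \<le> 1"
proof -
  obtain k where k: "0 < k" "(\<integral>\<^sup>+x. ennreal (\<Phi> (k * cmod (f x))) \<partial>M) < \<infinity>"
    and f[measurable]: "f \<in> borel_measurable M"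
    using assms(2) unfolding orlicz_space_def by blast
  note [measurable] = young_measurable[OF assms(1)]
  obtain c where c: "0 \<le> c" "(\<integral>\<^sup>+x. ennreal (\<Phi> (k * cmod (f x))) \<partial>M) = ennreal c"
    using k(2) by (cases "\<integral>\<^sup>+x. ennreal (\<Phi> (k * cmod (f x))) \<partial>M") auto
  define t where "t = max 1 c"
  have t: "1 \<le> t" "c \<le> t" by (simp_all add: t_def)
  have "(\<integral>\<^sup>+x. ennreal (\<Phi> (cmod (f x) / (t / k))) \<partial>M)
      \<le> (\<integral>\<^sup>+x. ennreal (1 / t) * ennreal (\<Phi> (k * cmod (f x))) \<partial>M)"
    using young_divide[OF assms(1) t(1), of "k * cmod (f _)"] t(1) young_nonneg[OF assms(1)]
    by (intro nn_integral_mono) (auto simp: ennreal_mult[symmetric] mult.commute intro!: ennreal_leI)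
  also have "\<dots> = ennreal (c / t)"
    using c t by (simp add: nn_integral_cmult ennreal_mult[symmetric])
  also have "\<dots> \<le> 1" using t by simp
  finally show thesis using k(1) t(1) by (intro that[of "t / k"]) auto
qed

lemma orlicz_norm_le:
  assumes "0 < k" "(\<integral>\<^sup>+x. ennreal (\<Phi> (cmod (f x) / k)) \<partial>M) \<le> 1"
  shows "orlicz_norm M \<Phi> f \<le> k"
  unfolding orlicz_norm_def
  using assms by (intro cInf_lower bdd_belowI[of _ 0]) (auto simp: norm_divide)

text \<open>A lower bound passes to an infimum of reals only over a nonempty set; membership in the
  Orlicz space provides that.\<close>

lemma orlicz_norm_ge:
  assumes "young_function \<Phi>" "f \<in> orlicz_space M \<Phi>"
    and "\<And>k. 0 < k \<Longrightarrow> (\<integral>\<^sup>+x. ennreal (\<Phi> (cmod (f x) / k)) \<partial>M) \<le> 1 \<Longrightarrow> c \<le> k"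
  shows "c \<le> orlicz_norm M \<Phi> f"
  unfolding orlicz_norm_def
proof (rule cInf_greatest)
  obtain k where k: "0 < k" "(\<integral>\<^sup>+x. ennreal (\<Phi> (cmod (f x) / k)) \<partial>M) \<le> 1"
    by (rule orlicz_modular_le_1[OF assms(1,2)])
  then have "k \<in> {k. k > 0 \<and> (\<integral>\<^sup>+x. ennreal (\<Phi> (cmod (f x / of_real k))) \<partial>M) \<le> 1}"
    by (simp add: norm_divide)
  then show "{k. k > 0 \<and> (\<integral>\<^sup>+x. ennreal (\<Phi> (cmod (f x / of_real k))) \<partial>M) \<le> 1} \<noteq> {}"
    by blast
qed (use assms(3) in \<open>auto simp: norm_divide\<close>)

text \<open>With a strict inequality some admissible \<open>k\<close> lies below \<open>L\<close>,
  and monotonicity of \<open>\<Phi>\<close> does the rest; attainment of the infimum is not at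
  issue.\<close>

lemma orlicz_modular_le_1_of_norm_less:
  assumes "young_function \<Phi>" "f \<in> orlicz_space M \<Phi>" "orlicz_norm M \<Phi> f < L"
  shows "(\<integral>\<^sup>+x. ennreal (\<Phi> (cmod (f x) / L)) \<partial>M) \<le> 1"
proof -
  obtain k where k: "0 < k" "(\<integral>\<^sup>+x. ennreal (\<Phi> (cmod (f x) / k)) \<partial>M) \<le> 1" "k < L"
    using orlicz_norm_ge[OF assms(1,2), of L] assms(3) by force
  have "(\<integral>\<^sup>+x. ennreal (\<Phi> (cmod (f x) / L)) \<partial>M) \<le> (\<integral>\<^sup>+x. ennreal (\<Phi> (cmod (f x) / k)) \<partial>M)"
    using k by (intro nn_integral_mono ennreal_leI young_mono[OF assms(1)] divide_left_mono) auto
  then show ?thesis using k(2) by order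
qed

section \<open>Atoms and non-atomic sets of a subalgebra\<close>

lemma AE_set_nn_integral_eq_0_iff:
  fixes f :: "'a \<Rightarrow> ennreal"
  assumes [measurable]: "f \<in> borel_measurable M" "A \<in> sets M"
  shows "(\<integral>\<^sup>+x\<in>A. f x \<partial>M) = 0 \<longleftrightarrow> (AE x in M. x \<in> A \<longrightarrow> f x = 0)"
  by (subst nn_integral_0_iff_AE) (auto simp: indicator_def)

context sigma_finite_subalgebra
begin

lemma sets_subalg: "A \<in> sets F \<Longrightarrow> A \<in> sets M"
  using subalg unfolding subalgebra_def by blast

lemma set_nn_integral_nn_cond_exp:
  assumes "f \<in> borel_measurable M" "A \<in> sets F"
  shows "(\<integral>\<^sup>+x\<in>A. nn_cond_exp M F f x \<partial>M) = (\<integral>\<^sup>+x\<in>A. f x \<partial>M)"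
  using nn_cond_exp_intg[of "indicator A" f] assms by (simp add: mult.commute)

text \<open>The exhausting sets must belong to \<open>F\<close>, so they are taken from the
  restriction of the measure to \<open>F\<close>. If all of them met \<open>A\<close> in null sets,
  \<open>A\<close> would be a countable union of null sets.\<close>

lemma subset_finite_measure:
  assumes "A \<in> sets F" "0 < emeasure M A"
  obtains S where "S \<in> sets F" "S \<subseteq> A" "0 < emeasure M S" "emeasure M S < \<infinity>"
proof -
  interpret R: sigma_finite_measure "restr_to_subalg M F" by (rule sigma_fin_subalg)
  obtain X :: "nat \<Rightarrow> 'a set" where X: "range X \<subseteq> sets F" "(\<Union>i. X i) = space M"
    "\<And>i. emeasure (restr_to_subalg M F) (X i) \<noteq> \<infinity>"
    using R.sigma_finite by (metis sets_restr_to_subalg[OF subalg] space_restr_to_subalg)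
  have "\<exists>i. emeasure M (A \<inter> X i) \<noteq> 0"
  proof (rule ccontr)
    assume "\<nexists>i. emeasure M (A \<inter> X i) \<noteq> 0"
    then have "(\<Union>i. A \<inter> X i) \<in> null_sets M"
      using X(1) assms(1) by (intro null_sets_UN null_setsI) (auto intro!: sets_subalg)
    moreover have "(\<Union>i. A \<inter> X i) = A"
      using X(2) sets.sets_into_space[OF sets_subalg[OF assms(1)]] by auto
    ultimately show False using assms(2) by auto
  qed
  then obtain i where i: "emeasure M (A \<inter> X i) \<noteq> 0" by blast
  have m: "X i \<in> sets F" "A \<inter> X i \<in> sets F" using X(1) assms(1) by auto
  have "emeasure M (A \<inter> X i) \<le> emeasure M (X i)"
    using m by (intro emeasure_mono) (auto intro: sets_subalg)
  also have "\<dots> < \<infinity>"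
    using X(3)[of i] emeasure_restr_to_subalg[OF subalg m(1)] by (simp add: less_top)
  finally show thesis using that[OF m(2)] i by (auto simp: zero_less_iff_neq_zero)
qed

text \<open>A part of finite positive measure must carry the measure of the whole atom.\<close>

lemma subalg_atom_finite:
  assumes "subalg_atom M F A" shows "emeasure M A < \<infinity>"
  using assms subset_finite_measure[of A] unfolding subalg_atom_def by (metis less_irrefl)

text \<open>A zero-one law. Finiteness of the atom is what turns a part of full measure into a part
  with null complement.\<close>

lemma subalg_atom_cases:
  assumes "subalg_atom M F A" "{x \<in> space F. P x} \<in> sets F"
  shows "(AE x in M. x \<in> A \<longrightarrow> P x) \<or> (AE x in M. x \<in> A \<longrightarrow> \<not> P x)"
proof -
  have A: "A \<in> sets F" and A0: "0 < emeasure M A"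
    and eq: "\<And>S. S \<in> sets F \<Longrightarrow> S \<subseteq> A \<Longrightarrow> emeasure M S = 0 \<or> emeasure M S = emeasure M A"
    using assms(1) unfolding subalg_atom_def by auto
  define S where "S = A \<inter> {x \<in> space F. P x}"
  have S: "S \<in> sets F" "S \<subseteq> A" using A assms(2) by (auto simp: S_def)
  have sp: "A \<subseteq> space M" "space F = space M"
    using sets.sets_into_space[OF sets_subalg[OF A]] subalg by (auto simp: subalgebra_def)
  from eq[OF S] show ?thesis
  proof
    assume "emeasure M S = 0"
    then have "S \<in> null_sets M" using S(1) by (auto intro: sets_subalg)
    then have "AE x in M. x \<notin> S" by (rule AE_not_in)
    then show ?thesis using sp by (intro disjI2) (auto simp: S_def)
  next
    assume "emeasure M S = emeasure M A"
    then have "emeasure M (A - S) = 0"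
      using subalg_atom_finite[OF assms(1)] S A
      by (subst emeasure_Diff) (auto intro: sets_subalg)
    then have "A - S \<in> null_sets M" using S(1) A by (auto intro: sets_subalg)
    then have "AE x in M. x \<notin> A - S" by (rule AE_not_in)
    then show ?thesis using sp by (intro disjI1) (auto simp: S_def)
  qed
qed

text \<open>The constant is the essential infimum of \<open>g\<close> on the atom, which exists
  because the order is complete. A countable order-dense set \<open>Q\<close> allows the exceptional
  null sets of all comparisons with \<open>c\<close> to be merged into one.\<close>

lemma subalg_atom_AE_const:
  fixes g :: "'a \<Rightarrow> 'b :: {complete_linorder, second_countable_topology, linorder_topology, dense_order}"
  assumes "subalg_atom M F A" and g: "g \<in> borel_measurable F"
  shows "\<exists>c. AE x in M. x \<in> A \<longrightarrow> g x = c"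
proof -
  obtain Q :: "'b set" where Q: "countable Q" "\<And>a b. a < b \<Longrightarrow> \<exists>q\<in>Q. a < q \<and> q < b"
  proof -
    obtain Q :: "'b set" where "countable Q" "\<And>X. open X \<Longrightarrow> X \<noteq> {} \<Longrightarrow> \<exists>d\<in>Q. d \<in> X"
      by (rule countable_dense_setE) blast
    moreover from this(2) have "\<exists>q\<in>Q. a < q \<and> q < b" if "a < b" for a b
      using that dense[OF that] by (metis open_greaterThanLessThan greaterThanLessThan_iff empty_iff)
    ultimately show thesis using that by blast
  qed
  define c where "c = Sup {t. AE x in M. x \<in> A \<longrightarrow> t \<le> g x}"
  have "AE x in M. x \<in> A \<longrightarrow> q \<le> g x" if q: "q < c" for q
  proof -
    obtain t where "q < t" "AE x in M. x \<in> A \<longrightarrow> t \<le> g x"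
      using q unfolding c_def less_Sup_iff by blast
    then show ?thesis by (auto elim!: eventually_mono)
  qed
  then have "AE x in M. \<forall>q\<in>Q. q < c \<longrightarrow> x \<in> A \<longrightarrow> q \<le> g x"
    using Q(1) by (simp add: AE_ball_countable)
  \<comment> \<open>Above \<open>c\<close> no \<open>q\<close> is an almost everywhere lower bound,
    so the zero-one law yields the opposite strict inequality almost everywhere on the atom.\<close>
  moreover have "AE x in M. x \<in> A \<longrightarrow> g x < q" if "c < q" for q
  proof -
    have "\<not> (AE x in M. x \<in> A \<longrightarrow> q \<le> g x)"
      using that Sup_upper[of q "{t. AE x in M. x \<in> A \<longrightarrow> t \<le> g x}"] unfolding c_def by auto
    moreover have "{x \<in> space F. q \<le> g x} \<in> sets F" using g by measurable
    ultimately show ?thesis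
      using subalg_atom_cases[OF assms(1), of "\<lambda>x. q \<le> g x"] by (auto simp: not_le)
  qed
  then have "AE x in M. \<forall>q\<in>Q. c < q \<longrightarrow> x \<in> A \<longrightarrow> g x < q"
    using Q(1) by (simp add: AE_ball_countable)
  ultimately have "AE x in M. x \<in> A \<longrightarrow> g x = c"
  proof eventually_elim
    case (elim x)
    show ?case
    proof (rule ccontr)
      assume "\<not> (x \<in> A \<longrightarrow> g x = c)"
      then show False using elim Q(2)[of "g x" c] Q(2)[of c "g x"]
        by (metis not_less_iff_gr_or_eq order.strict_trans1 order.asym)
    qed
  qed
  then show ?thesis by blast
qed

text \<open>An atom has positive measure, so two different constants cannot both be the value almost
  everywhere, and the description in \<open>atom_value\<close> is proper.\<close>

lemma atom_value_AE:
  fixes g :: "'a \<Rightarrow> 'b :: {complete_linorder, second_countable_topology, linorder_topology, dense_order}"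
  assumes "subalg_atom M F A" and g: "g \<in> borel_measurable F"
  shows "AE x in M. x \<in> A \<longrightarrow> g x = atom_value M g A"
proof -
  obtain c where c: "AE x in M. x \<in> A \<longrightarrow> g x = c"
    using subalg_atom_AE_const[OF assms] by blast
  have A: "A \<in> sets M" "0 < emeasure M A"
    using assms(1) sets_subalg unfolding subalg_atom_def by auto
  have "d = c" if "AE x in M. x \<in> A \<longrightarrow> g x = d" for d
  proof (rule ccontr)
    assume "d \<noteq> c"
    have "AE x in M. x \<notin> A"
      using c that by eventually_elim (use \<open>d \<noteq> c\<close> in auto)
    then show False using A by (simp add: AE_iff_null_sets[symmetric] null_setsD1)
  qed
  then have "atom_value M g A = c"
    unfolding atom_value_def using c by (intro the_equality)
  then show ?thesis using c by simp
qed

text \<open>Translates the products in the suprema of the theorem into plain integrals over atoms,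
  the only form in which they are used.\<close>

lemma atom_value_nn_cond_exp:
  assumes "subalg_atom M F A" "f \<in> borel_measurable M"
  shows "atom_value M (nn_cond_exp M F f) A * emeasure M A = (\<integral>\<^sup>+x\<in>A. f x \<partial>M)"
proof -
  have A: "A \<in> sets F" "A \<in> sets M"
    using assms(1) sets_subalg unfolding subalg_atom_def by auto
  have "(\<integral>\<^sup>+x\<in>A. f x \<partial>M) = (\<integral>\<^sup>+x\<in>A. nn_cond_exp M F f x \<partial>M)"
    using assms(2) A(1) by (rule set_nn_integral_nn_cond_exp[symmetric])
  also have "\<dots> = (\<integral>\<^sup>+x\<in>A. atom_value M (nn_cond_exp M F f) A \<partial>M)"
    using atom_value_AE[OF assms(1) borel_measurable_nn_cond_exp[of M F f]]
    by (intro nn_integral_cong_AE) (auto elim!: eventually_mono simp: indicator_def)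
  finally show ?thesis using A(2) by (simp add: nn_integral_cmult_indicator)
qed

section \<open>Sets of small measure in the non-atomic part\<close>

lemma subalg_nonatomic_halve:
  assumes "subalg_nonatomic M F B" "S \<in> sets F" "S \<subseteq> B" "0 < emeasure M S" "emeasure M S < \<infinity>"
  obtains T where "T \<in> sets F" "T \<subseteq> S" "0 < emeasure M T" "2 * emeasure M T \<le> emeasure M S"
proof -
  have "\<not> subalg_atom M F S"
    using assms unfolding subalg_nonatomic_def by blast
  then obtain T where T: "T \<in> sets F" "T \<subseteq> S" "emeasure M T \<noteq> 0" "emeasure M T \<noteq> emeasure M S"
    using assms unfolding subalg_atom_def by blast
  have add: "emeasure M S = emeasure M T + emeasure M (S - T)"
    using plus_emeasure[of T M "S - T"] T assms(2) by (simp add: sets_subalg sets.Diff Un_absorb1)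
  show thesis
  \<comment> \<open>Both \<open>T\<close> and \<open>S - T\<close> have positive measure, and the
    smaller of them has at most half the measure of \<open>S\<close>.\<close>
  proof (cases "emeasure M T \<le> emeasure M (S - T)")
    case True
    then show thesis
      using T add by (intro that[of T]) (auto simp: zero_less_iff_neq_zero mult_2 intro: add_left_mono)
  next
    case False
    then show thesis
      using T add assms(2)
      by (intro that[of "S - T"]) (auto simp: zero_less_iff_neq_zero mult_2 intro!: add_right_mono)
  qed
qed

text \<open>Iterated halving: after \<open>n\<close> rounds at most the fraction 1 / 2^n of the
  finite measure of \<open>S\<close> is left.\<close>

lemma subalg_nonatomic_small:
  assumes "subalg_nonatomic M F B" "S \<in> sets F" "S \<subseteq> B" "0 < emeasure M S" "emeasure M S < \<infinity>"
    and "0 < \<epsilon>"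
  obtains T where "T \<in> sets F" "T \<subseteq> S" "0 < measure M T" "measure M T < \<epsilon>" "emeasure M T < \<infinity>"
proof -
  have "\<exists>T\<in>sets F. T \<subseteq> S \<and> 0 < emeasure M T \<and> 2 ^ n * emeasure M T \<le> emeasure M S" for n
  proof (induction n)
    case 0
    then show ?case using assms by auto
  next
    case (Suc n)
    then obtain T where T: "T \<in> sets F" "T \<subseteq> S" "0 < emeasure M T" "2 ^ n * emeasure M T \<le> emeasure M S"
      by blast
    have "emeasure M T < \<infinity>"
      using emeasure_mono[OF T(2) sets_subalg[OF assms(2)]] assms(5) by order
    then obtain U where U: "U \<in> sets F" "U \<subseteq> T" "0 < emeasure M U" "2 * emeasure M U \<le> emeasure M T"
      using subalg_nonatomic_halve[OF assms(1) T(1)] T assms(3) by blast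
    have "2 ^ Suc n * emeasure M U = 2 ^ n * (2 * emeasure M U)" by (simp add: mult_ac)
    also have "\<dots> \<le> 2 ^ n * emeasure M T" using U(4) by (rule mult_left_mono) simp
    finally have "2 ^ Suc n * emeasure M U \<le> emeasure M S" using T(4) by order
    then show ?case using U T(2) by blast
  qed
  moreover obtain n where n: "measure M S / \<epsilon> < 2 ^ n"
    using real_arch_pow[of 2] by auto
  ultimately obtain T where T: "T \<in> sets F" "T \<subseteq> S" "0 < emeasure M T"
    "2 ^ n * emeasure M T \<le> emeasure M S" by blast
  have fin: "emeasure M T < \<infinity>"
    using emeasure_mono[OF T(2) sets_subalg[OF assms(2)]] assms(5) by order
  then have eq: "emeasure M T = ennreal (measure M T)" "emeasure M S = ennreal (measure M S)"
    using assms(5) by (simp_all add: emeasure_eq_ennreal_measure less_top)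
  have "(2::ennreal) ^ n = ennreal (2 ^ n)"
    by (simp add: ennreal_power[symmetric])
  then have "2 ^ n * measure M T \<le> measure M S"
    using T(4) unfolding eq by (simp add: ennreal_mult[symmetric])
  moreover have "measure M S < 2 ^ n * \<epsilon>" using n assms(6) by (simp add: field_simps)
  ultimately have "2 ^ n * measure M T < 2 ^ n * \<epsilon>" by linarith
  then have "measure M T < \<epsilon>" by simp
  moreover have "0 < measure M T" using T(3) eq(1) by simp
  ultimately show thesis using T fin by (intro that)
qed

end

section \<open>Boundedness from a dual bound on the atoms\<close>

text \<open>A converse of Hoelder's inequality for a weighted finite sum, and the first instance of
  the absorption argument. The \<open>g n\<close> are slopes of \<open>\<Psi>\<close> at
  \<open>h n / L\<close>, so the pairing equals \<open>L * (U + T)\<close>.\<close>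

lemma finite_orlicz_duality:
  fixes h p :: "'i \<Rightarrow> real"
  assumes \<Psi>: "young_function \<Psi>" and \<psi>: "young_function (complementary \<Psi>)"
    and S: "finite S" and h: "\<And>n. n \<in> S \<Longrightarrow> 0 \<le> h n" and p: "\<And>n. n \<in> S \<Longrightarrow> 0 \<le> p n" and "0 < L"
    and dual: "\<And>g. (\<And>n. n \<in> S \<Longrightarrow> 0 \<le> g n) \<Longrightarrow> (\<Sum>n\<in>S. complementary \<Psi> (g n) * p n) \<le> 1 \<Longrightarrow>
        (\<Sum>n\<in>S. h n * g n * p n) \<le> L"
  shows "(\<Sum>n\<in>S. \<Psi> (h n / L) * p n) \<le> 1"
proof -
  let ?\<psi> = "complementary \<Psi>"
  have "\<forall>n\<in>S. \<exists>y\<ge>0. (h n / L) * y = \<Psi> (h n / L) + ?\<psi> y"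
    using h \<open>0 < L\<close> by (intro ballI complementary_subgradient[OF \<Psi>]) simp
  then obtain g where g: "\<And>n. n \<in> S \<Longrightarrow> 0 \<le> g n"
    "\<And>n. n \<in> S \<Longrightarrow> (h n / L) * g n = \<Psi> (h n / L) + ?\<psi> (g n)"
    by metis
  define U where "U = (\<Sum>n\<in>S. \<Psi> (h n / L) * p n)"
  define T where "T = (\<Sum>n\<in>S. ?\<psi> (g n) * p n)"
  have T0: "0 \<le> T" unfolding T_def
    by (intro sum_nonneg mult_nonneg_nonneg young_nonneg[OF \<psi>] p)
  have "U + T = (\<Sum>n\<in>S. (h n / L) * g n * p n)"
    unfolding U_def T_def sum.distrib[symmetric]
    by (intro sum.cong refl) (simp only: g(2) distrib_right)
  also have "\<dots> = (\<Sum>n\<in>S. h n * g n * p n) / L"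
    by (simp add: sum_divide_distrib)
  finally have UT: "(\<Sum>n\<in>S. h n * g n * p n) = L * (U + T)"
    using \<open>0 < L\<close> by simp
  show ?thesis
  proof (cases "T \<le> 1")
    case True
    then have "L * (U + T) \<le> L"
      using dual[of g] g(1) UT by (simp add: T_def[symmetric])
    then have "U + T \<le> 1" using \<open>0 < L\<close> by simp
    then show ?thesis using T0 by (simp add: U_def)
  next
    case False
    then have T1: "1 < T" by simp
    \<comment> \<open>Here \<open>g\<close> is not admissible in \<open>dual\<close>, but by
      convexity \<open>g / T\<close> is; the resulting bound \<open>U + T \<le> T\<close> leaves
      nothing for \<open>U\<close>.\<close>
    have "(\<Sum>n\<in>S. ?\<psi> (g n / T) * p n) \<le> (\<Sum>n\<in>S. (?\<psi> (g n) / T) * p n)"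
      using T1 by (intro sum_mono mult_right_mono young_divide[OF \<psi>] p) auto
    also have "\<dots> = T / T" by (simp add: T_def[symmetric] sum_divide_distrib[symmetric])
    finally have "(\<Sum>n\<in>S. h n * (g n / T) * p n) \<le> L"
      using T1 g(1) by (intro dual) auto
    moreover have "(\<Sum>n\<in>S. h n * (g n / T) * p n) = L * (U + T) / T"
      unfolding UT[symmetric] by (simp add: sum_divide_distrib)
    ultimately have "L * (U + T) / T \<le> L" by (simp only:)
    then have "L * (U + T) \<le> L * T" using T1 by (simp add: pos_divide_le_eq)
    then have "U + T \<le> T" using \<open>0 < L\<close> by simp
    then show ?thesis by (simp add: U_def)
  qed
qed

section \<open>Hoelder's inequality over finitely many disjoint sets\<close>

lemma sum_set_nn_integral_disjoint:
  fixes f :: "'a \<Rightarrow> ennreal"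
  assumes "finite S" "disjoint_family_on A S"
    and [measurable]: "f \<in> borel_measurable M" "\<And>n. n \<in> S \<Longrightarrow> A n \<in> sets M"
  shows "(\<Sum>n\<in>S. \<integral>\<^sup>+x\<in>A n. f x \<partial>M) = (\<integral>\<^sup>+x\<in>(\<Union>n\<in>S. A n). f x \<partial>M)"
proof -
  have "(\<Sum>n\<in>S. \<integral>\<^sup>+x\<in>A n. f x \<partial>M) = (\<integral>\<^sup>+x. (\<Sum>n\<in>S. f x * indicator (A n) x) \<partial>M)"
    by (rule nn_integral_sum[symmetric]) measurable
  also have "\<dots> = (\<integral>\<^sup>+x\<in>(\<Union>n\<in>S. A n). f x \<partial>M)"
    using assms(1,2) by (simp add: sum_distrib_left[symmetric] indicator_UN_disjoint)
  finally show ?thesis .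
qed

text \<open>The modular of \<open>g n * cmod (u x)\<close> is bounded by \<open>C\<close> only, so
  Young's inequality is applied after dividing that factor by \<open>C\<close>. Multiplying back by
  \<open>k * C\<close> makes each of the two modulars contribute \<open>k * C\<close>.\<close>

lemma sum_set_nn_integral_Holder:
  fixes u f :: "'a \<Rightarrow> complex"
  assumes \<Phi>: "young_function \<Phi>" and \<phi>: "young_function (complementary \<Phi>)"
    and S: "finite S" "disjoint_family_on A S" and A: "\<And>n. n \<in> S \<Longrightarrow> A n \<in> sets M"
    and [measurable]: "u \<in> borel_measurable M" "f \<in> borel_measurable M"
    and g: "\<And>n. n \<in> S \<Longrightarrow> 0 \<le> g n"
    and "0 < k" and f1: "(\<integral>\<^sup>+x. ennreal (\<Phi> (cmod (f x) / k)) \<partial>M) \<le> 1"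
    and "1 \<le> C" and u: "(\<Sum>n\<in>S. \<integral>\<^sup>+x\<in>A n. ennreal (complementary \<Phi> (g n * cmod (u x))) \<partial>M) \<le> ennreal C"
  shows "(\<Sum>n\<in>S. ennreal (g n) * (\<integral>\<^sup>+x\<in>A n. ennreal (cmod (u x * f x)) \<partial>M)) \<le> ennreal (2 * k * C)"
proof -
  let ?\<phi> = "complementary \<Phi>"
  note [measurable] = young_measurable[OF \<Phi>] young_measurable[OF \<phi>] A
  have pt: "ennreal (g n) * ennreal (cmod (u x * f x)) \<le>
      ennreal (k * C) * ennreal (\<Phi> (cmod (f x) / k)) + ennreal k * ennreal (?\<phi> (g n * cmod (u x)))"
    if "n \<in> S" for n x
  proof -
    have "cmod (f x) / k * (g n * cmod (u x) / C)
        \<le> \<Phi> (cmod (f x) / k) + ?\<phi> (g n * cmod (u x) / C)"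
      using \<open>0 < k\<close> \<open>1 \<le> C\<close> g[OF that] by (intro young_inequality[OF \<Phi>]) auto
    also have "\<dots> \<le> \<Phi> (cmod (f x) / k) + ?\<phi> (g n * cmod (u x)) / C"
      using young_divide[OF \<phi> \<open>1 \<le> C\<close>] by simp
    finally have "k * C * (cmod (f x) / k * (g n * cmod (u x) / C))
        \<le> k * C * (\<Phi> (cmod (f x) / k) + ?\<phi> (g n * cmod (u x)) / C)"
      using \<open>0 < k\<close> \<open>1 \<le> C\<close> by (intro mult_left_mono) auto
    moreover have "k * C * (cmod (f x) / k * (g n * cmod (u x) / C)) = g n * cmod (u x * f x)"
      using \<open>0 < k\<close> \<open>1 \<le> C\<close> by (simp add: norm_mult)
    moreover have "k * C * (\<Phi> (cmod (f x) / k) + ?\<phi> (g n * cmod (u x)) / C)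
        = k * C * \<Phi> (cmod (f x) / k) + k * ?\<phi> (g n * cmod (u x))"
      using \<open>1 \<le> C\<close> by (simp add: distrib_left)
    ultimately have "g n * cmod (u x * f x) \<le> k * C * \<Phi> (cmod (f x) / k) + k * ?\<phi> (g n * cmod (u x))"
      by simp
    then show ?thesis
      using \<open>0 < k\<close> \<open>1 \<le> C\<close> g[OF that] young_nonneg[OF \<Phi>] young_nonneg[OF \<phi>]
      by (simp add: ennreal_mult[symmetric] ennreal_plus[symmetric] ennreal_leI del: ennreal_plus)
  qed
  have "(\<Sum>n\<in>S. ennreal (g n) * (\<integral>\<^sup>+x\<in>A n. ennreal (cmod (u x * f x)) \<partial>M))
      = (\<Sum>n\<in>S. \<integral>\<^sup>+x. (ennreal (g n) * ennreal (cmod (u x * f x))) * indicator (A n) x \<partial>M)"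
    by (intro sum.cong refl) (simp add: nn_integral_cmult mult.assoc)
  also have "\<dots> \<le> (\<Sum>n\<in>S. \<integral>\<^sup>+x. (ennreal (k * C) * ennreal (\<Phi> (cmod (f x) / k))
      + ennreal k * ennreal (?\<phi> (g n * cmod (u x)))) * indicator (A n) x \<partial>M)"
    by (intro sum_mono nn_integral_mono mult_right_mono pt) auto
  also have "\<dots> = (\<Sum>n\<in>S. ennreal (k * C) * (\<integral>\<^sup>+x\<in>A n. ennreal (\<Phi> (cmod (f x) / k)) \<partial>M)
      + ennreal k * (\<integral>\<^sup>+x\<in>A n. ennreal (?\<phi> (g n * cmod (u x))) \<partial>M))"
    by (intro sum.cong refl) (simp add: nn_integral_cmult nn_integral_add distrib_right mult.assoc)
  also have "\<dots> = ennreal (k * C) * (\<integral>\<^sup>+x\<in>(\<Union>n\<in>S. A n). ennreal (\<Phi> (cmod (f x) / k)) \<partial>M)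
      + ennreal k * (\<Sum>n\<in>S. \<integral>\<^sup>+x\<in>A n. ennreal (?\<phi> (g n * cmod (u x))) \<partial>M)"
    using S A by (simp add: sum.distrib sum_distrib_left[symmetric] sum_set_nn_integral_disjoint)
  also have "\<dots> \<le> ennreal (k * C) * 1 + ennreal k * ennreal C"
  proof (intro add_mono mult_left_mono u)
    have "(\<integral>\<^sup>+x\<in>(\<Union>n\<in>S. A n). ennreal (\<Phi> (cmod (f x) / k)) \<partial>M) \<le> (\<integral>\<^sup>+x. ennreal (\<Phi> (cmod (f x) / k)) \<partial>M)"
      by (intro nn_integral_mono) (auto simp: indicator_def)
    then show "(\<integral>\<^sup>+x\<in>(\<Union>n\<in>S. A n). ennreal (\<Phi> (cmod (f x) / k)) \<partial>M) \<le> 1" using f1 by order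
  qed auto
  also have "\<dots> = ennreal (2 * k * C)"
    using \<open>0 < k\<close> \<open>1 \<le> C\<close> by (simp add: ennreal_mult[symmetric] ennreal_plus[symmetric] del: ennreal_plus)
  finally show ?thesis .
qed

section \<open>From finite families of atoms to the operator\<close>

context sigma_finite_subalgebra
begin

lemma atomic_decompositionD:
  assumes "atomic_decomposition M F I A B"
  shows "\<And>n. n \<in> I \<Longrightarrow> subalg_atom M F (A n)" "\<And>n. n \<in> I \<Longrightarrow> A n \<in> sets F"
    "\<And>n. n \<in> I \<Longrightarrow> A n \<in> sets M" "disjoint_family_on A I" "subalg_nonatomic M F B"
    "B \<in> sets F" "B \<in> sets M" "space M = (\<Union>n\<in>I. A n) \<union> B"
  using assms sets_subalg
  unfolding atomic_decomposition_def subalg_atom_def subalg_nonatomic_def by auto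

lemma subalg_atom_measure:
  assumes "subalg_atom M F A"
  shows "emeasure M A = ennreal (measure M A)" "0 < measure M A"
proof -
  show *: "emeasure M A = ennreal (measure M A)"
    using subalg_atom_finite[OF assms] by (simp add: emeasure_eq_ennreal_measure)
  show "0 < measure M A"
    using assms * unfolding subalg_atom_def by (metis ennreal_less_zero_iff)
qed

text \<open>Infinitely many atoms are reached by monotone convergence along those with index below
  \<open>N\<close>; the remaining set \<open>B\<close> contributes nothing.\<close>

lemma nn_integral_le_of_atomic:
  assumes dec: "atomic_decomposition M F I A B" and [measurable]: "f \<in> borel_measurable M"
    and B: "AE x in M. x \<in> B \<longrightarrow> f x = 0"
    and le: "\<And>S. finite S \<Longrightarrow> S \<subseteq> I \<Longrightarrow> (\<Sum>n\<in>S. \<integral>\<^sup>+x\<in>A n. f x \<partial>M) \<le> c"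
  shows "(\<integral>\<^sup>+x. f x \<partial>M) \<le> c"
proof -
  note D = atomic_decompositionD[OF dec]
  define G where "G N x = f x * indicator (\<Union>n\<in>I \<inter> {..<N}. A n) x" for N :: nat and x
  have mono: "incseq G"
    by (intro incseq_SucI le_funI) (auto simp: G_def indicator_def)
  have [measurable]: "G N \<in> borel_measurable M" for N
    unfolding G_def using D(3) by measurable
  have "f x \<le> (SUP N. G N x)" if x: "x \<in> space M" "x \<in> B \<longrightarrow> f x = 0" for x
  proof (cases "x \<in> B")
    case False
    then obtain n where "n \<in> I" "x \<in> A n" using x(1) D(8) by auto
    then have "G (Suc n) x = f x" by (auto simp: G_def indicator_def)
    then show ?thesis by (metis SUP_upper UNIV_I)
  qed (use x in auto)
  then have "(\<integral>\<^sup>+x. f x \<partial>M) \<le> (\<integral>\<^sup>+x. (SUP N. G N x) \<partial>M)"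
    using B by (intro nn_integral_mono_AE) auto
  also have "\<dots> = (SUP N. \<integral>\<^sup>+x. G N x \<partial>M)"
    by (intro nn_integral_monotone_convergence_SUP mono) measurable
  also have "\<dots> \<le> c"
  proof (intro SUP_least)
    fix N
    have "(\<Sum>n\<in>I \<inter> {..<N}. \<integral>\<^sup>+x\<in>A n. f x \<partial>M) = (\<integral>\<^sup>+x. G N x \<partial>M)"
      unfolding G_def using D(3,4)
      by (intro sum_set_nn_integral_disjoint) (auto intro: disjoint_family_on_mono)
    then show "(\<integral>\<^sup>+x. G N x \<partial>M) \<le> c" using le[of "I \<inter> {..<N}"] by auto
  qed
  finally show ?thesis .
qed

text \<open>The conditional expectations of the real and the imaginary part are each dominated by
  that of the modulus. The crude factor 2 is harmless for boundedness.\<close>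

lemma cmod_complex_cond_exp_le:
  assumes [measurable]: "f \<in> borel_measurable M"
  shows "AE x in M. ennreal (cmod (complex_cond_exp M F f x)) \<le> 2 * nn_cond_exp M F (\<lambda>x. ennreal (cmod (f x))) x"
proof -
  have *: "AE x in M. ennreal \<bar>real_cond_exp M F g x\<bar> \<le> nn_cond_exp M F (\<lambda>x. ennreal (cmod (f x))) x"
    if [measurable]: "g \<in> borel_measurable M" and "\<And>x. \<bar>g x\<bar> \<le> cmod (f x)" for g
  proof -
    have "AE x in M. nn_cond_exp M F (\<lambda>x. ennreal \<bar>g x\<bar>) x \<le> nn_cond_exp M F (\<lambda>x. ennreal (cmod (f x))) x"
      using that by (intro nn_cond_exp_mono) (auto intro: ennreal_leI)
    with real_cond_exp_abs[OF that(1)] show ?thesis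
      by eventually_elim order
  qed
  have "AE x in M. ennreal \<bar>real_cond_exp M F (\<lambda>x. Re (f x)) x\<bar> \<le> nn_cond_exp M F (\<lambda>x. ennreal (cmod (f x))) x"
    by (intro * abs_Re_le_cmod) measurable
  moreover have "AE x in M. ennreal \<bar>real_cond_exp M F (\<lambda>x. Im (f x)) x\<bar> \<le> nn_cond_exp M F (\<lambda>x. ennreal (cmod (f x))) x"
    by (intro * abs_Im_le_cmod) measurable
  ultimately show ?thesis
  proof eventually_elim
    case (elim x)
    have "ennreal (cmod (complex_cond_exp M F f x)) \<le>
        ennreal (\<bar>real_cond_exp M F (\<lambda>x. Re (f x)) x\<bar> + \<bar>real_cond_exp M F (\<lambda>x. Im (f x)) x\<bar>)"
      using cmod_le[of "complex_cond_exp M F f x"] by (intro ennreal_leI) (simp add: complex_cond_exp_def)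
    also have "\<dots> \<le> 2 * nn_cond_exp M F (\<lambda>x. ennreal (cmod (f x))) x"
      using add_mono[OF elim] by (simp add: mult_2)
    finally show ?case .
  qed
qed

lemma measurable_complex_cond_exp [measurable]:
  "complex_cond_exp M F f \<in> borel_measurable F"
proof -
  have "complex_cond_exp M F f = (\<lambda>x. of_real (real_cond_exp M F (\<lambda>x. Re (f x)) x)
      + \<i> * of_real (real_cond_exp M F (\<lambda>x. Im (f x)) x))"
    by (simp add: complex_cond_exp_def complex_eq_iff fun_eq_iff)
  then show ?thesis by simp
qed

lemma set_nn_integral_complex_cond_exp_le:
  assumes [measurable]: "f \<in> borel_measurable M" and A: "A \<in> sets F"
  shows "(\<integral>\<^sup>+x\<in>A. ennreal (cmod (complex_cond_exp M F f x)) \<partial>M) \<le> 2 * (\<integral>\<^sup>+x\<in>A. ennreal (cmod (f x)) \<partial>M)"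
proof -
  note [measurable] = sets_subalg[OF A]
  have "(\<integral>\<^sup>+x\<in>A. ennreal (cmod (complex_cond_exp M F f x)) \<partial>M)
      \<le> (\<integral>\<^sup>+x. 2 * (nn_cond_exp M F (\<lambda>x. ennreal (cmod (f x))) x * indicator A x) \<partial>M)"
    using cmod_complex_cond_exp_le[OF assms(1)]
    by (intro nn_integral_mono_AE) (auto elim!: eventually_mono simp: indicator_def)
  also have "\<dots> = 2 * (\<integral>\<^sup>+x\<in>A. nn_cond_exp M F (\<lambda>x. ennreal (cmod (f x))) x \<partial>M)"
    by (intro nn_integral_cmult) measurable
  also have "\<dots> = 2 * (\<integral>\<^sup>+x\<in>A. ennreal (cmod (f x)) \<partial>M)"
    using A by (subst set_nn_integral_nn_cond_exp) auto
  finally show ?thesis .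
qed

text \<open>On an atom E(uf) has a constant modulus \<open>h n\<close>, so its modular is a weighted
  sum to which the finite duality applies; Hoelder's inequality verifies the dual bound that duality
  asks for.\<close>

lemma wct_bounded_of_dual_atomic_bound:
  assumes dec: "atomic_decomposition M F I A B"
    and \<Phi>: "young_function \<Phi>" and \<phi>: "young_function (complementary \<Phi>)"
    and \<Psi>: "young_function \<Psi>" and \<psi>: "young_function (complementary \<Psi>)"
    and u[measurable]: "u \<in> borel_measurable M"
    and D: "D \<subseteq> orlicz_space M \<Phi>"
    and B: "AE x in M. x \<in> B \<longrightarrow> u x = 0"
    and C: "\<And>S g. finite S \<Longrightarrow> S \<subseteq> I \<Longrightarrow> (\<And>n. n \<in> S \<Longrightarrow> 0 \<le> g n) \<Longrightarrow>
      (\<Sum>n\<in>S. complementary \<Psi> (g n) * measure M (A n)) \<le> 1 \<Longrightarrow>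
      (\<Sum>n\<in>S. \<integral>\<^sup>+x\<in>A n. ennreal (complementary \<Phi> (g n * cmod (u x))) \<partial>M) \<le> ennreal C"
  shows "wct_bounded M F \<Phi> \<Psi> u D"
proof -
  note Dec = atomic_decompositionD[OF dec]
  define C' where "C' = max 1 C"
  have C': "1 \<le> C'" "C \<le> C'" by (auto simp: C'_def)
  \<comment> \<open>The estimate is made for every \<open>k\<close> admissible in the norm of
    \<open>f\<close>; the infimum over \<open>k\<close> is taken at the end.\<close>
  have "orlicz_norm M \<Psi> (wct M F u f) \<le> (4 * C') * k"
    if f: "f \<in> D" and k: "0 < k" "(\<integral>\<^sup>+x. ennreal (\<Phi> (cmod (f x) / k)) \<partial>M) \<le> 1" for f k
  proof -
    have [measurable]: "f \<in> borel_measurable M"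
      using D f by (auto simp: orlicz_space_def)
    define H where "H = wct M F u f"
    have HF[measurable]: "H \<in> borel_measurable F"
      by (simp add: H_def wct_def)
    then have [measurable]: "H \<in> borel_measurable M"
      using measurable_from_subalg[OF subalg] by blast
    note [measurable] = young_measurable[OF \<Psi>]
    have HA: "(\<integral>\<^sup>+x\<in>E. ennreal (cmod (H x)) \<partial>M) \<le> 2 * (\<integral>\<^sup>+x\<in>E. ennreal (cmod (u x * f x)) \<partial>M)"
      if "E \<in> sets F" for E
      unfolding H_def wct_def by (intro set_nn_integral_complex_cond_exp_le that) measurable
    have "\<exists>c\<ge>0. AE x in M. x \<in> A n \<longrightarrow> cmod (H x) = c" if n: "n \<in> I" for n
    proof -
      \<comment> \<open>Constancy on atoms was shown for values in a complete order, hence the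
        detour through \<open>ennreal\<close>.\<close>
      obtain c where c: "AE x in M. x \<in> A n \<longrightarrow> ennreal (cmod (H x)) = c"
        using subalg_atom_AE_const[OF Dec(1)[OF n], of "\<lambda>x. ennreal (cmod (H x))"] by auto
      then have "AE x in M. x \<in> A n \<longrightarrow> cmod (H x) = enn2real c"
        by eventually_elim auto
      then show ?thesis using enn2real_nonneg by blast
    qed
    then obtain h where h: "\<And>n. n \<in> I \<Longrightarrow> 0 \<le> h n"
      "\<And>n. n \<in> I \<Longrightarrow> AE x in M. x \<in> A n \<longrightarrow> cmod (H x) = h n"
      by metis
    \<comment> \<open>Used twice: with the identity for the dual pairing, and with
      \<open>\<Psi>\<close> of the quotient by \<open>L\<close> for the modular.\<close>
    have const: "(\<integral>\<^sup>+x\<in>A n. ennreal (\<theta> (cmod (H x))) \<partial>M) = ennreal (\<theta> (h n) * measure M (A n))"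
      if n: "n \<in> I" and \<theta>: "\<And>x. 0 \<le> x \<Longrightarrow> 0 \<le> \<theta> x" for n and \<theta> :: "real \<Rightarrow> real"
    proof -
      have "(\<integral>\<^sup>+x\<in>A n. ennreal (\<theta> (cmod (H x))) \<partial>M) = (\<integral>\<^sup>+x\<in>A n. ennreal (\<theta> (h n)) \<partial>M)"
        using h(2)[OF n] by (intro nn_integral_cong_AE) (auto elim!: eventually_mono simp: indicator_def)
      then show ?thesis
        using subalg_atom_measure[OF Dec(1)[OF n]] Dec(3)[OF n] \<theta>[OF h(1)[OF n]]
        by (simp add: nn_integral_cmult_indicator ennreal_mult)
    qed
    \<comment> \<open>One factor 2 stems from the complex conditional expectation, the other from
      Hoelder's inequality.\<close>
    define L where "L = 4 * C' * k"
    have L: "0 < L" using C' k by (simp add: L_def)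
    have fin: "(\<Sum>n\<in>S. \<Psi> (h n / L) * measure M (A n)) \<le> 1" if S: "finite S" "S \<subseteq> I" for S
    proof (rule finite_orlicz_duality[OF \<Psi> \<psi> S(1) _ _ L])
      fix g assume g: "\<And>n. n \<in> S \<Longrightarrow> 0 \<le> g n"
        and g1: "(\<Sum>n\<in>S. complementary \<Psi> (g n) * measure M (A n)) \<le> 1"
      have nn: "0 \<le> h n * g n * measure M (A n)" if "n \<in> S" for n
        using that S g h(1) by auto
      have "ennreal (\<Sum>n\<in>S. h n * g n * measure M (A n)) = (\<Sum>n\<in>S. ennreal (h n * g n * measure M (A n)))"
        using nn by (intro sum_ennreal[symmetric])
      also have "\<dots> = (\<Sum>n\<in>S. ennreal (g n) * (\<integral>\<^sup>+x\<in>A n. ennreal (cmod (H x)) \<partial>M))"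
      proof (intro sum.cong refl)
        fix n assume n: "n \<in> S"
        then show "ennreal (h n * g n * measure M (A n)) = ennreal (g n) * (\<integral>\<^sup>+x\<in>A n. ennreal (cmod (H x)) \<partial>M)"
          using const[of n "\<lambda>x. x"] S g[OF n] h(1)[of n]
          by (auto simp: ennreal_mult[symmetric] mult_ac)
      qed
      also have "\<dots> \<le> (\<Sum>n\<in>S. ennreal (g n) * (2 * (\<integral>\<^sup>+x\<in>A n. ennreal (cmod (u x * f x)) \<partial>M)))"
        using S Dec(2) by (intro sum_mono mult_left_mono HA) auto
      also have "\<dots> = 2 * (\<Sum>n\<in>S. ennreal (g n) * (\<integral>\<^sup>+x\<in>A n. ennreal (cmod (u x * f x)) \<partial>M))"
        by (simp add: sum_distrib_left mult_ac)
      also have "\<dots> \<le> 2 * ennreal (2 * k * C')"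
      proof (intro mult_left_mono sum_set_nn_integral_Holder[OF \<Phi> \<phi>] S(1) g k C'(1))
        show "disjoint_family_on A S"
          using Dec(4) S(2) by (rule disjoint_family_on_mono[rotated])
        have "(\<Sum>n\<in>S. \<integral>\<^sup>+x\<in>A n. ennreal (complementary \<Phi> (g n * cmod (u x))) \<partial>M) \<le> ennreal C"
          using S g g1 by (rule C)
        also have "\<dots> \<le> ennreal C'" using C'(2) by (rule ennreal_leI)
        finally show "(\<Sum>n\<in>S. \<integral>\<^sup>+x\<in>A n. ennreal (complementary \<Phi> (g n * cmod (u x))) \<partial>M) \<le> ennreal C'" .
      qed (use S Dec(3) in auto)
      also have "\<dots> = ennreal L"
        using C' k by (simp add: L_def ennreal_numeral[symmetric] ennreal_mult[symmetric] mult_ac del: ennreal_numeral)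
      finally show "(\<Sum>n\<in>S. h n * g n * measure M (A n)) \<le> L"
        using L by (simp add: ennreal_le_iff)
    qed (use S h in auto)
    have "(\<integral>\<^sup>+x. ennreal (\<Psi> (cmod (H x) / L)) \<partial>M) \<le> 1"
    \<comment> \<open>Since \<open>B\<close> belongs to the subalgebra, the integral of |E(uf)| over
      \<open>B\<close> is controlled by that of |uf|, which is 0 there.\<close>
    proof (rule nn_integral_le_of_atomic[OF dec])
      have "(\<integral>\<^sup>+x\<in>B. ennreal (cmod (u x * f x)) \<partial>M) = 0"
        using B Dec(7) by (subst AE_set_nn_integral_eq_0_iff) auto
      then have "(\<integral>\<^sup>+x\<in>B. ennreal (cmod (H x)) \<partial>M) = 0"
        using HA[OF Dec(6)] by simp
      then have "AE x in M. x \<in> B \<longrightarrow> H x = 0"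
        using Dec(7) by (subst (asm) AE_set_nn_integral_eq_0_iff) auto
      then show "AE x in M. x \<in> B \<longrightarrow> ennreal (\<Psi> (cmod (H x) / L)) = 0"
        by eventually_elim (simp add: young_zero[OF \<Psi>])
    next
      fix S assume S: "finite S" "S \<subseteq> I"
      have "(\<Sum>n\<in>S. \<integral>\<^sup>+x\<in>A n. ennreal (\<Psi> (cmod (H x) / L)) \<partial>M)
          = (\<Sum>n\<in>S. ennreal (\<Psi> (h n / L) * measure M (A n)))"
        using S by (intro sum.cong refl const) (auto intro: young_nonneg[OF \<Psi>])
      also have "\<dots> = ennreal (\<Sum>n\<in>S. \<Psi> (h n / L) * measure M (A n))"
        by (intro sum_ennreal mult_nonneg_nonneg young_nonneg[OF \<Psi>]) auto
      also have "\<dots> \<le> 1" using fin[OF S] by simp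
      finally show "(\<Sum>n\<in>S. \<integral>\<^sup>+x\<in>A n. ennreal (\<Psi> (cmod (H x) / L)) \<partial>M) \<le> 1" .
    qed measurable
    then show ?thesis
      unfolding H_def[symmetric] L_def[symmetric] by (intro orlicz_norm_le L)
  qed
  then have "orlicz_norm M \<Psi> (wct M F u f) / (4 * C') \<le> orlicz_norm M \<Phi> f" if "f \<in> D" for f
    using that D C' by (intro orlicz_norm_ge[OF \<Phi>]) (auto simp: field_simps)
  then show ?thesis
    unfolding wct_bounded_def using C' by (intro exI[of _ "4 * C'"]) (auto simp: field_simps)
qed

text \<open>The common core of the two alternatives in part (a): each of them delivers
  \<open>bound\<close> with its own \<open>a\<close> and \<open>C\<close>. Submultiplicativity
  separates \<open>g n\<close> from \<open>u\<close> under the integral, and convexity of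
  \<open>\<Theta>\<close> makes the resulting terms summable.\<close>

lemma wct_bounded_of_delta_prime:
  assumes dec: "atomic_decomposition M F I A B"
    and \<Phi>: "young_function \<Phi>" and \<phi>: "young_function (complementary \<Phi>)"
    and \<Psi>: "young_function \<Psi>" and \<psi>: "young_function (complementary \<Psi>)"
    and u[measurable]: "u \<in> borel_measurable M"
    and D: "D \<subseteq> orlicz_space M \<Phi>"
    and delta: "delta_prime (complementary \<Phi>)"
    and B: "AE x in M. x \<in> B \<longrightarrow> nn_cond_exp M F (\<lambda>x. ennreal (complementary \<Phi> (cmod (u x)))) x = 0"
    and \<Theta>: "young_function \<Theta>" and a: "0 \<le> a" and C: "0 \<le> C"
    and bound: "\<And>n y. n \<in> I \<Longrightarrow> 0 \<le> y \<Longrightarrow>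
      (\<integral>\<^sup>+x\<in>A n. ennreal (complementary \<Phi> (cmod (u x))) \<partial>M) * ennreal (complementary \<Phi> y)
        \<le> ennreal (C * \<Theta> (complementary \<Psi> y * measure M (A n) * a))"
  shows "wct_bounded M F \<Phi> \<Psi> u D"
proof -
  let ?\<phi> = "complementary \<Phi>" and ?\<psi> = "complementary \<Psi>"
  note Dec = atomic_decompositionD[OF dec]
  note [measurable] = young_measurable[OF \<phi>]
  obtain c where c: "0 < c" "\<And>x y. 0 \<le> x \<Longrightarrow> 0 \<le> y \<Longrightarrow> ?\<phi> (x * y) \<le> c * ?\<phi> x * ?\<phi> y"
    using delta unfolding delta_prime_def by blast
  show ?thesis
  \<comment> \<open>The vanishing of the conditional expectation on \<open>B\<close> passes to
    \<open>u\<close> through the integral over \<open>B\<close>, because \<open>?\<phi>\<close> is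
    zero only at 0.\<close>
  proof (rule wct_bounded_of_dual_atomic_bound[OF dec \<Phi> \<phi> \<Psi> \<psi> u D])
    have "(\<integral>\<^sup>+x\<in>B. ennreal (?\<phi> (cmod (u x))) \<partial>M) = (\<integral>\<^sup>+x\<in>B. nn_cond_exp M F (\<lambda>x. ennreal (?\<phi> (cmod (u x)))) x \<partial>M)"
      using Dec(6) by (intro set_nn_integral_nn_cond_exp[symmetric]) auto
    also have "\<dots> = 0"
      using B Dec(7) by (subst AE_set_nn_integral_eq_0_iff) auto
    finally have "AE x in M. x \<in> B \<longrightarrow> ennreal (?\<phi> (cmod (u x))) = 0"
      using Dec(7) by (subst (asm) AE_set_nn_integral_eq_0_iff) auto
    then show "AE x in M. x \<in> B \<longrightarrow> u x = 0"
    proof eventually_elim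
      case (elim x)
      then show ?case using young_nonneg[OF \<phi>, of "cmod (u x)"] young_eq_0_iff[OF \<phi>, of "cmod (u x)"]
        by (simp add: ennreal_eq_0_iff)
    qed
  next
    fix S and g :: "nat \<Rightarrow> real" assume S: "finite S" "S \<subseteq> I" and g: "\<And>n. n \<in> S \<Longrightarrow> 0 \<le> g n"
      and g1: "(\<Sum>n\<in>S. ?\<psi> (g n) * measure M (A n)) \<le> 1"
    have summand: "(\<integral>\<^sup>+x\<in>A n. ennreal (?\<phi> (g n * cmod (u x))) \<partial>M)
        \<le> ennreal (c * C * \<Theta> a * (?\<psi> (g n) * measure M (A n)))" if n: "n \<in> S" for n
    proof -
      have nI: "n \<in> I" using n S by auto
      note [measurable] = Dec(3)[OF nI]
      define t where "t = ?\<psi> (g n) * measure M (A n)"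
      have t0: "0 \<le> t" unfolding t_def by (intro mult_nonneg_nonneg young_nonneg[OF \<psi>]) simp
      have "t \<le> (\<Sum>n\<in>S. ?\<psi> (g n) * measure M (A n))"
        unfolding t_def using n S(1)
        by (intro member_le_sum[where f="\<lambda>n. ?\<psi> (g n) * measure M (A n)"] mult_nonneg_nonneg young_nonneg[OF \<psi>]) auto
      then have t1: "t \<le> 1" using g1 by linarith
      have "(\<integral>\<^sup>+x\<in>A n. ennreal (?\<phi> (g n * cmod (u x))) \<partial>M)
          \<le> (\<integral>\<^sup>+x. ennreal (c * ?\<phi> (g n)) * (ennreal (?\<phi> (cmod (u x))) * indicator (A n) x) \<partial>M)"
        using c g[OF n] young_nonneg[OF \<phi>]
        by (intro nn_integral_mono) (auto simp: indicator_def ennreal_mult[symmetric] intro!: ennreal_leI)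
      also have "\<dots> = ennreal c * ((\<integral>\<^sup>+x\<in>A n. ennreal (?\<phi> (cmod (u x))) \<partial>M) * ennreal (?\<phi> (g n)))"
        using c young_nonneg[OF \<phi>] by (subst nn_integral_cmult) (auto simp: ennreal_mult mult_ac)
      also have "\<dots> \<le> ennreal c * ennreal (C * \<Theta> (t * a))"
        unfolding t_def using bound[OF nI g[OF n]] by (intro mult_left_mono) auto
      also have "\<dots> = ennreal (c * (C * \<Theta> (t * a)))"
        using c(1) by (simp add: ennreal_mult')
      also have "\<dots> \<le> ennreal (c * (C * (t * \<Theta> a)))"
        using c(1) C by (intro ennreal_leI mult_left_mono young_scale[OF \<Theta> t0 t1]) auto
      finally show ?thesis by (simp add: t_def mult_ac)
    qed
    have nn: "0 \<le> c * C * \<Theta> a" using c(1) C young_nonneg[OF \<Theta>] by simp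
    have "(\<Sum>n\<in>S. \<integral>\<^sup>+x\<in>A n. ennreal (?\<phi> (g n * cmod (u x))) \<partial>M)
        \<le> (\<Sum>n\<in>S. ennreal (c * C * \<Theta> a * (?\<psi> (g n) * measure M (A n))))"
      by (intro sum_mono summand)
    also have "\<dots> = ennreal (c * C * \<Theta> a * (\<Sum>n\<in>S. ?\<psi> (g n) * measure M (A n)))"
      unfolding sum_distrib_left
      by (intro sum_ennreal mult_nonneg_nonneg[OF nn] mult_nonneg_nonneg[OF young_nonneg[OF \<psi>]]) auto
    also have "\<dots> \<le> ennreal (c * C * \<Theta> a)"
      using nn g1 by (intro ennreal_leI) (simp add: mult_left_le)
    finally show "(\<Sum>n\<in>S. \<integral>\<^sup>+x\<in>A n. ennreal (?\<phi> (g n * cmod (u x))) \<partial>M) \<le> ennreal (c * C * \<Theta> a)" .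
  qed
qed

end

section \<open>Necessary conditions for boundedness\<close>

text \<open>\<open>X\<close> plays the role of the derivative of the complementary function. It is
  selected by choice, and monotonicity is what makes it Borel measurable, so that test functions can
  be built from it.\<close>

lemma complementary_mono_selection:
  assumes \<Phi>: "young_function \<Phi>"
  obtains X where "mono X" "\<And>v. 0 \<le> X v" "\<And>v. 0 \<le> v \<Longrightarrow> X v * v = \<Phi> (X v) + complementary \<Phi> v"
proof -
  have "\<exists>x. 0 \<le> x \<and> (\<forall>z\<ge>0. z * \<bar>y\<bar> - \<Phi> z \<le> x * \<bar>y\<bar> - \<Phi> x) \<and> x * \<bar>y\<bar> = \<Phi> x + complementary \<Phi> y" for y
    by (rule complementary_attained[OF \<Phi>, of y]) blast
  then obtain Y where Y: "\<And>y. 0 \<le> Y y" "\<And>y z. 0 \<le> z \<Longrightarrow> z * \<bar>y\<bar> - \<Phi> z \<le> Y y * \<bar>y\<bar> - \<Phi> (Y y)"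
    "\<And>y. Y y * \<bar>y\<bar> = \<Phi> (Y y) + complementary \<Phi> y"
    by metis
  have lt: "Y v \<le> Y v'" if "0 \<le> v" "v < v'" for v v'
  proof -
    \<comment> \<open>The sum of the two maximality inequalities, each maximiser being compared with
      the other.\<close>
    have "(Y v' - Y v) * (v' - v) \<ge> 0"
      using Y(2)[of "Y v'" v] Y(2)[of "Y v" v'] Y(1) that by (simp add: algebra_simps)
    then show ?thesis using that by (simp add: zero_le_mult_iff)
  qed
  have "mono (\<lambda>v. Y (max 0 v))"
  proof (rule monoI)
    fix v v' :: real assume "v \<le> v'"
    then show "Y (max 0 v) \<le> Y (max 0 v')"
      using lt[of 0 v'] lt[of v v'] by (cases "v = v'"; cases "v' = 0") (auto simp: max_def)
  qed
  then show thesis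
  proof (rule that)
    fix v :: real assume "0 \<le> v"
    then show "Y (max 0 v) * v = \<Phi> (Y (max 0 v)) + complementary \<Phi> v" using Y(3)[of v] by simp
  qed (rule Y(1))
qed

text \<open>Hoelder's inequality against the indicator of \<open>A\<close>, scaled by the
  \<open>s\<close> for which its dual modular \<open>complementary \<Psi> s * m\<close> is exactly
  1.\<close>

lemma set_nn_integral_norm_le:
  assumes \<Psi>: "young_function \<Psi>" and \<psi>: "young_function (complementary \<Psi>)"
    and H: "H \<in> orlicz_space M \<Psi>" "orlicz_norm M \<Psi> H < L" and "0 < L"
    and A: "A \<in> sets M" "emeasure M A = ennreal m" "0 < m"
  shows "(\<integral>\<^sup>+x\<in>A. ennreal (cmod (H x)) \<partial>M) \<le> ennreal (2 * L / half_inv (complementary \<Psi>) (1 / m))"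
proof -
  define s where "s = half_inv (complementary \<Psi>) (1 / m)"
  have s: "0 < s" "complementary \<Psi> s = 1 / m"
    using half_inv_pos[OF \<psi>, of "1 / m"] half_inv_right[OF \<psi>, of "1 / m"] A(3) by (auto simp: s_def)
  have [measurable]: "H \<in> borel_measurable M" "A \<in> sets M" using H(1) A(1) by (auto simp: orlicz_space_def)
  note [measurable] = young_measurable[OF \<Psi>]
  have pt: "ennreal (cmod (H x)) \<le> ennreal (L / s) * ennreal (\<Psi> (cmod (H x) / L)) + ennreal (L / (s * m))" for x
  proof -
    have "cmod (H x) / L * s \<le> \<Psi> (cmod (H x) / L) + 1 / m"
      using young_inequality[OF \<Psi>, of "cmod (H x) / L" s] s \<open>0 < L\<close> by simp
    then have "(L / s) * (cmod (H x) / L * s) \<le> (L / s) * (\<Psi> (cmod (H x) / L) + 1 / m)"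
      using s \<open>0 < L\<close> by (intro mult_left_mono) auto
    moreover have "(L / s) * (cmod (H x) / L * s) = cmod (H x)"
      using s \<open>0 < L\<close> by simp
    moreover have "(L / s) * (\<Psi> (cmod (H x) / L) + 1 / m) = (L / s) * \<Psi> (cmod (H x) / L) + L / (s * m)"
      by (simp add: distrib_left)
    ultimately show ?thesis
      using s \<open>0 < L\<close> A(3) young_nonneg[OF \<Psi>]
      by (simp add: ennreal_mult[symmetric] ennreal_plus[symmetric] ennreal_leI del: ennreal_plus)
  qed
  have "(\<integral>\<^sup>+x\<in>A. ennreal (cmod (H x)) \<partial>M)
      \<le> (\<integral>\<^sup>+x. ennreal (L / s) * ennreal (\<Psi> (cmod (H x) / L)) + ennreal (L / (s * m)) * indicator A x \<partial>M)"
    by (intro nn_integral_mono) (auto simp: indicator_def pt)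
  also have "\<dots> = ennreal (L / s) * (\<integral>\<^sup>+x. ennreal (\<Psi> (cmod (H x) / L)) \<partial>M) + ennreal (L / (s * m)) * ennreal m"
    by (simp add: nn_integral_add nn_integral_cmult nn_integral_cmult_indicator A)
  also have "\<dots> \<le> ennreal (L / s) * 1 + ennreal (L / (s * m)) * ennreal m"
    by (intro add_right_mono mult_left_mono orlicz_modular_le_1_of_norm_less[OF \<Psi> H]) auto
  also have "\<dots> = ennreal (2 * L / s)"
    using s \<open>0 < L\<close> A(3) by (simp add: ennreal_mult[symmetric] ennreal_plus[symmetric] del: ennreal_plus)
  finally show ?thesis by (simp add: s_def)
qed

section \<open>Testing the operator on sets of the subalgebra\<close>

context sigma_finite_subalgebra
begin

lemma set_nn_integral_le_complex_cond_exp: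
  assumes g: "integrable M g" "\<And>x. 0 \<le> g x" and A: "A \<in> sets F"
  shows "(\<integral>\<^sup>+x\<in>A. ennreal (g x) \<partial>M) \<le> (\<integral>\<^sup>+x\<in>A. ennreal (cmod (complex_cond_exp M F (\<lambda>x. of_real (g x)) x)) \<partial>M)"
proof -
  note [measurable] = sets_subalg[OF A]
  let ?r = "real_cond_exp M F g"
  have r: "integrable M ?r" by (rule real_cond_exp_int(1)[OF g(1)])
  have "(\<integral>\<^sup>+x\<in>A. ennreal (g x) \<partial>M) = ennreal (\<integral>x\<in>A. g x \<partial>M)"
    using g by (intro nn_set_integral_eq_set_integral) auto
  also have "\<dots> = ennreal (\<integral>x\<in>A. ?r x \<partial>M)"
    by (simp add: real_cond_exp_intA[OF g(1) A])
  also have "\<dots> \<le> ennreal (\<integral>x\<in>A. \<bar>?r x\<bar> \<partial>M)"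
    using r by (intro ennreal_leI set_integral_mono) (auto simp: set_integrable_def intro!: integrable_mult_indicator[where 'b=real, unfolded real_scaleR_def])
  also have "\<dots> = (\<integral>\<^sup>+x\<in>A. ennreal \<bar>?r x\<bar> \<partial>M)"
    using r by (intro nn_set_integral_eq_set_integral[symmetric]) auto
  also have "\<dots> \<le> (\<integral>\<^sup>+x\<in>A. ennreal (cmod (complex_cond_exp M F (\<lambda>x. of_real (g x)) x)) \<partial>M)"
    using abs_Re_le_cmod[of "complex_cond_exp M F (\<lambda>x. of_real (g x)) _"]
    by (intro nn_integral_mono mult_right_mono ennreal_leI) (auto simp: complex_cond_exp_def)
  finally show ?thesis .
qed

text \<open>The second instance of the absorption argument. The test function has no prescribed
  norm; boundedness is applied with its norm estimated by the maximum of 1 and its modular.\<close>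

lemma set_modular_le_1_of_wct_bounded:
  assumes \<Phi>: "young_function \<Phi>" and \<phi>: "young_function (complementary \<Phi>)"
    and \<Psi>: "young_function \<Psi>" and \<psi>: "young_function (complementary \<Psi>)"
    and u[measurable]: "u \<in> borel_measurable M"
    and wd: "wct_well_defined M F \<Psi> u (orlicz_space M \<Phi>)"
    and bd: "\<And>f. f \<in> orlicz_space M \<Phi> \<Longrightarrow> orlicz_norm M \<Psi> (wct M F u f) \<le> K * orlicz_norm M \<Phi> f"
    and K: "1 \<le> K"
    and A: "A \<in> sets F" "emeasure M A = ennreal m" "0 < m"
  shows "(\<integral>\<^sup>+x\<in>A. ennreal (complementary \<Phi> (half_inv (complementary \<Psi>) (1 / m) * cmod (u x) / (4 * K))) \<partial>M) \<le> 1"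
proof -
  let ?\<phi> = "complementary \<Phi>"
  define s where "s = half_inv (complementary \<Psi>) (1 / m)"
  have s: "0 < s"
    using half_inv_pos[OF \<psi>, of "1 / m"] A(3) by (auto simp: s_def)
  note [measurable] = young_measurable[OF \<Phi>] young_measurable[OF \<phi>] sets_subalg[OF A(1)]
  obtain X where X: "mono X" "\<And>v. 0 \<le> X v" "\<And>v. 0 \<le> v \<Longrightarrow> X v * v = \<Phi> (X v) + ?\<phi> v"
    by (rule complementary_mono_selection[OF \<Phi>]) blast
  have [measurable]: "X \<in> borel_measurable borel" by (rule borel_measurable_mono[OF X(1)])
  have X0: "X 0 = 0"
    using X(3)[of 0] young_zero[OF \<phi>] young_eq_0_iff[OF \<Phi>] by simp
  \<comment> \<open>The divisor combines \<open>K\<close>, the 2 that makes the norm inequality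
    strict and the 2 of \<open>set_nn_integral_norm_le\<close>, so that all constants cancel in the
    end.\<close>
  define v where "v x = s * cmod (u x) / (4 * K)" for x
  have v0: "0 \<le> v x" for x using s K by (simp add: v_def)
  have [measurable]: "cnj \<in> borel_measurable borel" "complex_of_real \<in> borel_measurable borel"
    by (intro borel_measurable_continuous_onI continuous_intros)+
  have [measurable]: "v \<in> borel_measurable M" unfolding v_def by measurable
  \<comment> \<open>Bounding \<open>u\<close> on a set of finite measure makes both modulars finite,
    as cancellation requires, and makes \<open>u * f\<close> integrable.\<close>
  have trunc: "(\<integral>\<^sup>+x. ennreal (?\<phi> (v x)) * indicator (A \<inter> {x \<in> space M. cmod (u x) \<le> real N}) x \<partial>M) \<le> 1" for N
  proof -
    define E where "E = A \<inter> {x \<in> space M. cmod (u x) \<le> real N}"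
    have E[measurable]: "E \<in> sets M" unfolding E_def by measurable
    have EA: "E \<subseteq> A" by (auto simp: E_def)
    have vb: "v x \<le> s * real N / (4 * K)" if "x \<in> E" for x
      using that s K unfolding v_def E_def by (intro divide_right_mono mult_left_mono) auto
    define \<beta> where "\<beta> = X (s * real N / (4 * K))"
    have Xb: "X (v x) \<le> \<beta>" if "x \<in> E" for x
      unfolding \<beta>_def using monoD[OF X(1) vb[OF that]] .
    \<comment> \<open>Where \<open>u x = 0\<close> the phase is 0 by the convention for division by
      zero; since \<open>X 0 = 0\<close>, the formula for \<open>cmod (f x)\<close> survives
      there.\<close>
    define f :: "'a \<Rightarrow> complex" where
      "f x = of_real (indicator E x * X (v x)) * (cnj (u x) / of_real (cmod (u x)))" for x
    have [measurable]: "f \<in> borel_measurable M" unfolding f_def by measurable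
    have absf: "cmod (f x) = indicator E x * X (v x)" for x
      using X(2)[of "v x"] X0 by (cases "u x = 0") (auto simp: f_def norm_mult norm_divide v_def)
    have uf: "u x * f x = of_real (cmod (u x) * cmod (f x))" for x
    proof -
      have "u x * (cnj (u x) / of_real (cmod (u x))) = of_real (cmod (u x))"
        using complex_norm_square[of "u x"] by (cases "u x = 0") (auto simp: power2_eq_square field_simps)
      then show ?thesis
        unfolding absf unfolding f_def by (metis mult.left_commute mult.commute of_real_mult)
    qed
    have finA: "(\<integral>\<^sup>+x. ennreal c * indicator E x \<partial>M) < \<infinity>" for c
    proof -
      have "emeasure M E \<le> emeasure M A" using EA by (intro emeasure_mono) auto
      then have "emeasure M E < \<infinity>" using A(2) by (metis ennreal_less_top infinity_ennreal_def order.strict_trans1)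
      then show ?thesis by (simp add: nn_integral_cmult_indicator ennreal_mult_less_top)
    qed
    have T_fin: "(\<integral>\<^sup>+x. ennreal (\<Phi> (cmod (f x))) \<partial>M) < \<infinity>"
    proof -
      have "(\<integral>\<^sup>+x. ennreal (\<Phi> (cmod (f x))) \<partial>M) \<le> (\<integral>\<^sup>+x. ennreal (\<Phi> \<beta>) * indicator E x \<partial>M)"
        using Xb X(2) by (intro nn_integral_mono)
          (auto simp: absf indicator_def young_zero[OF \<Phi>] intro!: ennreal_leI young_mono[OF \<Phi>])
      also note finA
      finally show ?thesis .
    qed
    have U_fin: "(\<integral>\<^sup>+x. ennreal (?\<phi> (v x)) * indicator E x \<partial>M) < \<infinity>"
    proof -
      have "(\<integral>\<^sup>+x. ennreal (?\<phi> (v x)) * indicator E x \<partial>M)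
          \<le> (\<integral>\<^sup>+x. ennreal (?\<phi> (s * real N / (4 * K))) * indicator E x \<partial>M)"
        using vb v0 by (intro nn_integral_mono)
          (auto simp: indicator_def intro!: ennreal_leI young_mono[OF \<phi>])
      also note finA
      finally show ?thesis .
    qed
    obtain T where T: "0 \<le> T" "(\<integral>\<^sup>+x. ennreal (\<Phi> (cmod (f x))) \<partial>M) = ennreal T"
      using T_fin by (cases "\<integral>\<^sup>+x. ennreal (\<Phi> (cmod (f x))) \<partial>M") auto
    obtain U where U: "0 \<le> U" "(\<integral>\<^sup>+x. ennreal (?\<phi> (v x)) * indicator E x \<partial>M) = ennreal U"
      using U_fin by (cases "\<integral>\<^sup>+x. ennreal (?\<phi> (v x)) * indicator E x \<partial>M") auto
    have f: "f \<in> orlicz_space M \<Phi>"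
      unfolding orlicz_space_def using T_fin by (auto intro!: exI[of _ 1])
    define T1 where "T1 = max 1 T"
    have T1: "1 \<le> T1" "T \<le> T1" by (auto simp: T1_def)
    have "(\<integral>\<^sup>+x. ennreal (\<Phi> (cmod (f x) / T1)) \<partial>M) \<le> (\<integral>\<^sup>+x. ennreal (1 / T1) * ennreal (\<Phi> (cmod (f x))) \<partial>M)"
      using young_divide[OF \<Phi> T1(1)] T1(1) young_nonneg[OF \<Phi>]
      by (intro nn_integral_mono) (auto simp: ennreal_mult[symmetric] intro!: ennreal_leI)
    also have "\<dots> = ennreal (T / T1)"
      using T T1 by (simp add: nn_integral_cmult ennreal_mult[symmetric])
    also have "\<dots> \<le> 1" using T1 by simp
    finally have Nf: "orlicz_norm M \<Phi> f \<le> T1"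
      using T1 by (intro orlicz_norm_le) auto
    have "orlicz_norm M \<Psi> (wct M F u f) \<le> K * T1"
      using bd[OF f] Nf K by (meson mult_left_mono order.trans zero_le_one)
    also have "\<dots> < 2 * K * T1" using K T1 by simp
    finally have NH: "orlicz_norm M \<Psi> (wct M F u f) < 2 * K * T1" .
    have H: "wct M F u f \<in> orlicz_space M \<Psi>"
      using wd f unfolding wct_well_defined_def by blast
    \<comment> \<open>The equality case of Young's inequality, integrated: outside \<open>E\<close>
      both sides vanish.\<close>
    have UT: "ennreal (U + T) = ennreal (s / (4 * K)) * (\<integral>\<^sup>+x\<in>A. ennreal (cmod (u x) * cmod (f x)) \<partial>M)"
    proof -
      have pt: "ennreal (?\<phi> (v x)) * indicator E x + ennreal (\<Phi> (cmod (f x)))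
          = ennreal (s / (4 * K)) * (ennreal (cmod (u x) * cmod (f x)) * indicator A x)" for x
      proof (cases "x \<in> E")
        case True
        have "?\<phi> (v x) + \<Phi> (X (v x)) = s / (4 * K) * (cmod (u x) * X (v x))"
          using X(3)[OF v0[of x]] by (simp add: v_def mult_ac)
        then show ?thesis
          using True EA s K X(2)[of "v x"] young_nonneg[OF \<Phi>] young_nonneg[OF \<phi>]
          by (auto simp: absf ennreal_mult[symmetric] ennreal_plus[symmetric] simp del: ennreal_plus)
      qed (simp add: absf young_zero[OF \<Phi>])
      have "ennreal (U + T) = (\<integral>\<^sup>+x. ennreal (?\<phi> (v x)) * indicator E x \<partial>M) + (\<integral>\<^sup>+x. ennreal (\<Phi> (cmod (f x))) \<partial>M)"
        using U T by simp
      also have "\<dots> = (\<integral>\<^sup>+x. ennreal (?\<phi> (v x)) * indicator E x + ennreal (\<Phi> (cmod (f x))) \<partial>M)"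
        by (intro nn_integral_add[symmetric]) measurable
      also have "\<dots> = (\<integral>\<^sup>+x. ennreal (s / (4 * K)) * (ennreal (cmod (u x) * cmod (f x)) * indicator A x) \<partial>M)"
        by (simp only: pt)
      also have "\<dots> = ennreal (s / (4 * K)) * (\<integral>\<^sup>+x\<in>A. ennreal (cmod (u x) * cmod (f x)) \<partial>M)"
        by (intro nn_integral_cmult) measurable
      finally show ?thesis .
    qed
    have int: "integrable M (\<lambda>x. cmod (u x) * cmod (f x))"
    proof (rule integrableI_nonneg)
      have "(\<integral>\<^sup>+x. ennreal (cmod (u x) * cmod (f x)) \<partial>M) \<le> (\<integral>\<^sup>+x. ennreal (real N * \<beta>) * indicator E x \<partial>M)"
        using Xb X(2) by (intro nn_integral_mono)
          (auto simp: absf indicator_def E_def intro!: ennreal_leI mult_mono)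
      also note finA
      finally show "(\<integral>\<^sup>+x. ennreal (cmod (u x) * cmod (f x)) \<partial>M) < \<infinity>" .
    qed auto
    have "(\<integral>\<^sup>+x\<in>A. ennreal (cmod (u x) * cmod (f x)) \<partial>M) \<le> (\<integral>\<^sup>+x\<in>A. ennreal (cmod (wct M F u f x)) \<partial>M)"
      using set_nn_integral_le_complex_cond_exp[OF int _ A(1)] by (simp add: wct_def uf)
    also have "\<dots> \<le> ennreal (2 * (2 * K * T1) / s)"
      unfolding s_def using K T1 A by (intro set_nn_integral_norm_le[OF \<Psi> \<psi> H NH]) auto
    finally have "ennreal (U + T) \<le> ennreal (s / (4 * K)) * ennreal (2 * (2 * K * T1) / s)"
      unfolding UT by (rule mult_left_mono) simp
    also have "\<dots> = ennreal T1"
      using s K T1 by (simp add: ennreal_mult[symmetric])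
    finally have "U + T \<le> T1" using T1 by simp
    \<comment> \<open>Either \<open>T1 = 1\<close>, and \<open>U\<close> is at most 1, or
      \<open>T1 = T\<close>, and \<open>U\<close> is 0.\<close>
    then have "U \<le> 1" using T(1) U(1) by (simp add: T1_def max_def split: if_splits)
    then show ?thesis using U by (simp add: E_def)
  qed
  have "(\<integral>\<^sup>+x\<in>A. ennreal (?\<phi> (v x)) \<partial>M)
      = (\<integral>\<^sup>+x. (SUP N. ennreal (?\<phi> (v x)) * indicator (A \<inter> {x \<in> space M. cmod (u x) \<le> real N}) x) \<partial>M)"
  proof (intro nn_integral_cong antisym)
    fix x assume x: "x \<in> space M"
    obtain N where "cmod (u x) \<le> real N" using real_arch_simple by blast
    then have "ennreal (?\<phi> (v x)) * indicator A x
        = ennreal (?\<phi> (v x)) * indicator (A \<inter> {x \<in> space M. cmod (u x) \<le> real N}) x"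
      using x by (auto simp: indicator_def)
    then show "ennreal (?\<phi> (v x)) * indicator A x
        \<le> (SUP N. ennreal (?\<phi> (v x)) * indicator (A \<inter> {x \<in> space M. cmod (u x) \<le> real N}) x)"
      by (metis (no_types, lifting) SUP_upper UNIV_I)
    show "(SUP N. ennreal (?\<phi> (v x)) * indicator (A \<inter> {x \<in> space M. cmod (u x) \<le> real N}) x)
        \<le> ennreal (?\<phi> (v x)) * indicator A x"
      by (intro SUP_least) (auto simp: indicator_def)
  qed
  also have "\<dots> = (SUP N. \<integral>\<^sup>+x. ennreal (?\<phi> (v x)) * indicator (A \<inter> {x \<in> space M. cmod (u x) \<le> real N}) x \<partial>M)"
    by (intro nn_integral_monotone_convergence_SUP incseq_SucI le_funI)
      (auto simp: indicator_def)
  also have "\<dots> \<le> 1" by (intro SUP_least trunc)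
  finally show ?thesis by (simp add: v_def s_def)
qed

lemma wct_bounded_imp_set_modular_bound:
  assumes \<Phi>: "young_function \<Phi>" and \<phi>: "young_function (complementary \<Phi>)"
    and \<Psi>: "young_function \<Psi>" and \<psi>: "young_function (complementary \<Psi>)"
    and u[measurable]: "u \<in> borel_measurable M"
    and wd: "wct_well_defined M F \<Psi> u (orlicz_space M \<Phi>)"
    and bd: "wct_bounded M F \<Phi> \<Psi> u (orlicz_space M \<Phi>)"
    and nabla: "nabla_prime (complementary \<Phi>)"
  obtains C where "0 < C" "\<And>A m. A \<in> sets F \<Longrightarrow> emeasure M A = ennreal m \<Longrightarrow> 0 < m \<Longrightarrow>
      (\<integral>\<^sup>+x\<in>A. ennreal (complementary \<Phi> (cmod (u x))) \<partial>M)
        * ennreal (complementary \<Phi> (half_inv (complementary \<Psi>) (1 / m))) \<le> ennreal C"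
proof -
  let ?\<phi> = "complementary \<Phi>"
  obtain K0 where K0: "\<And>f. f \<in> orlicz_space M \<Phi> \<Longrightarrow> orlicz_norm M \<Psi> (wct M F u f) \<le> K0 * orlicz_norm M \<Phi> f"
    using bd unfolding wct_bounded_def by blast
  \<comment> \<open>\<open>K0\<close> may be small or even negative; enlarging it is harmless
    because norms on the Orlicz space are nonnegative.\<close>
  define K where "K = max 1 K0"
  have K: "1 \<le> K" by (simp add: K_def)
  have bd: "orlicz_norm M \<Psi> (wct M F u f) \<le> K * orlicz_norm M \<Phi> f" if "f \<in> orlicz_space M \<Phi>" for f
  proof -
    have "0 \<le> orlicz_norm M \<Phi> f" using orlicz_norm_ge[OF \<Phi> that, of 0] by simp
    then have "K0 * orlicz_norm M \<Phi> f \<le> K * orlicz_norm M \<Phi> f"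
      by (intro mult_right_mono) (auto simp: K_def)
    then show ?thesis using K0[OF that] by linarith
  qed
  obtain b where b: "0 < b" "\<And>x y. 0 \<le> x \<Longrightarrow> 0 \<le> y \<Longrightarrow> ?\<phi> x * ?\<phi> y \<le> ?\<phi> (b * x * y)"
    using nabla unfolding nabla_prime_def by blast
  \<comment> \<open>Supermultiplicativity is used twice, for \<open>?\<phi> s * ?\<phi> y\<close>
    and then with the extra factor \<open>?\<phi> z\<close>. This \<open>z\<close> cancels both
    constants \<open>b\<close> and produces the divisor \<open>4 * K\<close>.\<close>
  define z where "z = 1 / (b * b * (4 * K))"
  have z: "0 < z" using b K by (simp add: z_def)
  have \<phi>z: "0 < ?\<phi> z" using z by (intro young_pos[OF \<phi>]) simp
  note [measurable] = young_measurable[OF \<phi>]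
  show thesis
  proof (rule that[of "1 / ?\<phi> z"])
    show "0 < 1 / ?\<phi> z" using \<phi>z by simp
    fix A m assume A: "A \<in> sets F" "emeasure M A = ennreal m" "0 < m"
    note [measurable] = sets_subalg[OF A(1)]
    define s where "s = half_inv (complementary \<Psi>) (1 / m)"
    have s: "0 < s" using half_inv_pos[OF \<psi>, of "1 / m"] A(3) by (auto simp: s_def)
    have pt: "?\<phi> s * ?\<phi> y \<le> 1 / ?\<phi> z * ?\<phi> (s * y / (4 * K))" if y: "0 \<le> y" for y
    proof -
      have "?\<phi> s * ?\<phi> y * ?\<phi> z \<le> ?\<phi> (b * s * y) * ?\<phi> z"
        using b s y \<phi>z by (intro mult_right_mono) auto
      also have "\<dots> \<le> ?\<phi> (b * (b * s * y) * z)"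
        using b s y z by (intro b) auto
      also have "b * (b * s * y) * z = s * y / (4 * K)"
        using b K by (simp add: z_def)
      finally show ?thesis using \<phi>z by (simp add: field_simps)
    qed
    have "(\<integral>\<^sup>+x\<in>A. ennreal (?\<phi> (cmod (u x))) \<partial>M) * ennreal (?\<phi> s)
        = (\<integral>\<^sup>+x. ennreal (?\<phi> s) * (ennreal (?\<phi> (cmod (u x))) * indicator A x) \<partial>M)"
      by (simp add: nn_integral_cmult mult.commute)
    also have "\<dots> \<le> (\<integral>\<^sup>+x. ennreal (1 / ?\<phi> z) * (ennreal (?\<phi> (s * cmod (u x) / (4 * K))) * indicator A x) \<partial>M)"
      using pt[of "cmod (u _)"] \<phi>z young_nonneg[OF \<phi>]
      by (intro nn_integral_mono) (auto simp: indicator_def ennreal_mult[symmetric] intro!: ennreal_leI)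
    also have "\<dots> = ennreal (1 / ?\<phi> z) * (\<integral>\<^sup>+x\<in>A. ennreal (?\<phi> (s * cmod (u x) / (4 * K))) \<partial>M)"
      by (intro nn_integral_cmult) measurable
    also have "\<dots> \<le> ennreal (1 / ?\<phi> z) * 1"
      unfolding s_def using set_modular_le_1_of_wct_bounded[OF \<Phi> \<phi> \<Psi> \<psi> u wd bd K A]
      by (intro mult_left_mono) auto
    finally show "(\<integral>\<^sup>+x\<in>A. ennreal (?\<phi> (cmod (u x))) \<partial>M) * ennreal (?\<phi> (half_inv (complementary \<Psi>) (1 / m)))
        \<le> ennreal (1 / ?\<phi> z)" by (simp add: s_def)
  qed
qed

text \<open>If the conditional expectation were at least \<open>\<delta>\<close> on a set of
  positive measure, sets of small measure \<open>m\<close> inside it would give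
  \<open>\<delta> * m * \<theta> (1 / m) \<le> C\<close>, against superlinear growth of
  \<open>\<theta>\<close>.\<close>

lemma nonatomic_AE_zero:
  assumes na: "subalg_nonatomic M F B" and \<theta>: "young_function (even_extension \<theta>)"
    and w[measurable]: "w \<in> borel_measurable M" and "0 < C"
    and C: "\<And>A m. A \<in> sets F \<Longrightarrow> emeasure M A = ennreal m \<Longrightarrow> 0 < m \<Longrightarrow>
      (\<integral>\<^sup>+x\<in>A. w x \<partial>M) * ennreal (\<theta> (1 / m)) \<le> ennreal C"
  shows "AE x in M. x \<in> B \<longrightarrow> nn_cond_exp M F w x = 0"
proof -
  let ?W = "nn_cond_exp M F w"
  have B: "B \<in> sets F" using na by (simp add: subalg_nonatomic_def)
  have "AE x in M. x \<in> B \<longrightarrow> ?W x < ennreal (1 / Suc n)" for n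
  proof (rule ccontr)
    assume not: "\<not> ?thesis"
    define \<delta> where "\<delta> = 1 / real (Suc n)"
    have \<delta>: "0 < \<delta>" by (simp add: \<delta>_def)
    define G where "G = B \<inter> {x \<in> space F. ennreal \<delta> \<le> ?W x}"
    have G: "G \<in> sets F" unfolding G_def using B by measurable
    have sp: "space F = space M" using subalg by (simp add: subalgebra_def)
    have "emeasure M G \<noteq> 0"
    proof
      assume "emeasure M G = 0"
      then have "AE x in M. x \<notin> G" using sets_subalg[OF G] by (intro AE_not_in) auto
      then have "AE x in M. x \<in> B \<longrightarrow> ?W x < ennreal (1 / Suc n)"
        using AE_space by eventually_elim (auto simp: G_def sp \<delta>_def not_le)
      then show False using not by simp
    qed
    then obtain S where S: "S \<in> sets F" "S \<subseteq> G" "0 < emeasure M S" "emeasure M S < \<infinity>"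
      using subset_finite_measure[OF G] by (auto simp: zero_less_iff_neq_zero)
    \<comment> \<open>With slope \<open>2 * C / \<delta>\<close> the product above becomes at least
      \<open>2 * C\<close>, which exceeds \<open>C\<close>.\<close>
    obtain R where R: "0 < R" "\<And>x. R \<le> x \<Longrightarrow> (2 * C / \<delta>) * x \<le> \<theta> \<bar>x\<bar>"
      using young_superlinear[OF \<theta>, of "2 * C / \<delta>"] unfolding even_extension_def by blast
    have "S \<subseteq> B" using S(2) by (auto simp: G_def)
    then obtain T where T: "T \<in> sets F" "T \<subseteq> S" "0 < measure M T" "measure M T < 1 / R" "emeasure M T < \<infinity>"
      using subalg_nonatomic_small[OF na S(1) _ S(3,4), of "1 / R"] R(1) by auto
    define m where "m = measure M T"
    have m: "emeasure M T = ennreal m" "0 < m"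
      using T by (simp_all add: m_def emeasure_eq_ennreal_measure)
    have "R \<le> 1 / m" using T(4) R(1) m(2) by (simp add: m_def field_simps)
    then have \<theta>m: "2 * C / \<delta> * (1 / m) \<le> \<theta> (1 / m)" using R(2)[of "1 / m"] m(2) by simp
    note [measurable] = sets_subalg[OF T(1)]
    have "ennreal \<delta> * ennreal m = (\<integral>\<^sup>+x\<in>T. ennreal \<delta> \<partial>M)"
      by (simp add: nn_integral_cmult_indicator m)
    also have "\<dots> \<le> (\<integral>\<^sup>+x\<in>T. ?W x \<partial>M)"
      using S(2) T(2) by (intro nn_integral_mono) (auto simp: indicator_def G_def)
    also have "\<dots> = (\<integral>\<^sup>+x\<in>T. w x \<partial>M)" by (rule set_nn_integral_nn_cond_exp[OF w T(1)])
    finally have "ennreal \<delta> * ennreal m * ennreal (2 * C / \<delta> * (1 / m)) \<le> (\<integral>\<^sup>+x\<in>T. w x \<partial>M) * ennreal (\<theta> (1 / m))"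
      using \<theta>m by (intro mult_mono ennreal_leI) auto
    also have "\<dots> \<le> ennreal C" by (rule C[OF T(1) m])
    finally have "\<delta> * m * (2 * C / \<delta> * (1 / m)) \<le> C"
      using \<delta> m(2) \<open>0 < C\<close> by (simp add: ennreal_mult[symmetric])
    then show False using \<delta> m(2) \<open>0 < C\<close> by simp
  qed
  then have "AE x in M. \<forall>n. x \<in> B \<longrightarrow> ?W x < ennreal (1 / Suc n)"
    unfolding AE_all_countable by blast
  then show ?thesis
  proof eventually_elim
    case (elim x)
    show ?case
    proof
      assume x: "x \<in> B"
      have "?W x \<le> 0"
      proof (rule ennreal_le_epsilon)
        fix e :: real assume "0 < e"
        then obtain n where "inverse (real (Suc n)) < e" using reals_Archimedean by blast
        then have "ennreal (1 / Suc n) \<le> ennreal e" by (intro ennreal_leI) (simp add: divide_inverse)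
        moreover have "?W x < ennreal (1 / Suc n)" using elim x by blast
        ultimately have "?W x \<le> ennreal e" by order
        then show "?W x \<le> 0 + ennreal e" by simp
      qed
      then show "?W x = 0" by simp
    qed
  qed
qed

end

section \<open>The main theorem\<close>

theorem theorem2p3:
  fixes M \<A> :: "'a measure"
    and I :: "nat set" and A :: "nat \<Rightarrow> 'a set" and B :: "'a set"
    and \<Phi> \<Psi> :: "real \<Rightarrow> real"
    and u :: "'a \<Rightarrow> complex" and D :: "('a \<Rightarrow> complex) set"
  defines "\<Phi>s \<equiv> complementary \<Phi>"
    and "\<Psi>s \<equiv> complementary \<Psi>"
    and "E\<Phi>u \<equiv> cond_modular M \<A> (complementary \<Phi>) (\<lambda>x. cnj (u x))"
  assumes "sigma_finite_measure M"
    and "sigma_finite_subalgebra M \<A>"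
    and "atomic_decomposition M \<A> I A B"
    and "young_function \<Phi>" and "young_function \<Phi>s"
    and "young_function \<Psi>" and "young_function \<Psi>s"
    and "u \<in> borel_measurable M"
    and "function_subspace D" and "D \<subseteq> orlicz_space M \<Phi>"
    and "wct_well_defined M \<A> \<Psi> u D"
  shows
    "(\<forall>\<Theta>. young_function \<Theta> \<and> dominated_globally (\<Phi>s \<circ> half_inv \<Psi>s) \<Theta> \<longrightarrow>
        (delta_prime \<Phi>s \<and> nabla_prime \<Theta> \<and>
         (AE x in M. x \<in> B \<longrightarrow> E\<Phi>u x = 0) \<and>
         (SUP n\<in>I. atom_value M E\<Phi>u (A n) * emeasure M (A n)
            / ennreal (\<Phi>s (half_inv \<Psi>s (measure M (A n))))) < \<infinity>
         \<longrightarrow> wct_bounded M \<A> \<Phi> \<Psi> u D) \<and>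
        (delta_prime \<Phi>s \<and> delta_prime (half_inv \<Psi>s) \<and>
         (SUP n\<in>I. atom_value M E\<Phi>u (A n) * emeasure M (A n)
            * ennreal (\<Phi>s (half_inv \<Psi>s (1 / measure M (A n))))) < \<infinity> \<and>
         (AE x in M. x \<in> B \<longrightarrow> E\<Phi>u x = 0)
         \<longrightarrow> wct_bounded M \<A> \<Phi> \<Psi> u D))
     \<and>
     (young_function (even_extension (\<Phi>s \<circ> half_inv \<Psi>s)) \<and> nabla_prime \<Phi>s \<and>
      wct_well_defined M \<A> \<Psi> u (orlicz_space M \<Phi>) \<and>
      wct_bounded M \<A> \<Phi> \<Psi> u (orlicz_space M \<Phi>)
      \<longrightarrow>
      (AE x in M. x \<in> B \<longrightarrow> E\<Phi>u x = 0) \<and>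
      (SUP n\<in>I. atom_value M E\<Phi>u (A n) * emeasure M (A n)
         * ennreal (\<Phi>s (half_inv \<Psi>s (1 / measure M (A n))))) < \<infinity>)"
proof -
  interpret sigma_finite_subalgebra M \<A> by fact
  note dec = \<open>atomic_decomposition M \<A> I A B\<close> and u[measurable] = \<open>u \<in> borel_measurable M\<close>
  have \<Phi>: "young_function \<Phi>" and \<phi>: "young_function (complementary \<Phi>)"
    and \<Psi>: "young_function \<Psi>" and \<psi>: "young_function (complementary \<Psi>)"
    using assms by (simp_all add: \<Phi>s_def \<Psi>s_def)
  note Dec = atomic_decompositionD[OF dec]
  note [measurable] = young_measurable[OF \<phi>]
  define w where "w x = ennreal (\<Phi>s (cmod (u x)))" for x
  have [measurable]: "w \<in> borel_measurable M" unfolding w_def \<Phi>s_def by measurable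
  \<comment> \<open>Conjugation drops out because only the modulus of \<open>u\<close>
    enters.\<close>
  have E: "E\<Phi>u = nn_cond_exp M \<A> w"
    by (simp add: E\<Phi>u_def cond_modular_def w_def[abs_def] \<Phi>s_def)
  have atom: "atom_value M E\<Phi>u (A n) * emeasure M (A n) = (\<integral>\<^sup>+x\<in>A n. w x \<partial>M)" if "n \<in> I" for n
    unfolding E by (intro atom_value_nn_cond_exp Dec(1) that) measurable
  note atom_meas = subalg_atom_measure[OF Dec(1)]
  define p where "p n = measure M (A n)" for n
  have p: "0 < p n" if "n \<in> I" for n using atom_meas(2)[OF that] by (simp add: p_def)
  define \<theta> where "\<theta> x = \<Phi>s (half_inv \<Psi>s x)" for x
  have \<theta>_nonneg: "0 \<le> \<theta> x" for x using young_nonneg[OF \<phi>] by (simp add: \<theta>_def \<Phi>s_def)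
  have \<theta>_pos: "0 < \<theta> x" if "0 < x" for x
    using half_inv_pos[OF \<psi> that] young_pos[OF \<phi>] by (simp add: \<theta>_def \<Phi>s_def \<Psi>s_def)
  \<comment> \<open>Rewrites a value of \<open>\<Phi>s\<close> as one of \<open>\<theta>\<close> at
    \<open>\<Psi>s y\<close>, so that it can be multiplied with \<open>\<theta>\<close> at a measure
    or its reciprocal.\<close>
  have \<theta>_\<Psi>s: "\<Phi>s y = \<theta> (\<Psi>s y)" if "0 \<le> y" for y
    using half_inv_left[OF \<psi> that] by (simp add: \<theta>_def \<Psi>s_def)
  have \<Psi>s_nonneg: "0 \<le> \<Psi>s y" for y using young_nonneg[OF \<psi>] by (simp add: \<Psi>s_def)

  have bounded: "wct_bounded M \<A> \<Phi> \<Psi> u D"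
    if "delta_prime \<Phi>s" "AE x in M. x \<in> B \<longrightarrow> E\<Phi>u x = 0" "young_function \<Theta>" "0 \<le> a" "0 \<le> C"
      "\<And>n y. n \<in> I \<Longrightarrow> 0 \<le> y \<Longrightarrow> (\<integral>\<^sup>+x\<in>A n. w x \<partial>M) * ennreal (\<Phi>s y) \<le> ennreal (C * \<Theta> (\<Psi>s y * p n * a))"
    for \<Theta> a C
    using that assms
    by (intro wct_bounded_of_delta_prime[OF dec \<Phi> \<phi> \<Psi> \<psi> u, of D \<Theta> a C])
      (simp_all add: E w_def[abs_def] \<Phi>s_def \<Psi>s_def p_def)

  have part_a: "wct_bounded M \<A> \<Phi> \<Psi> u D"
    if \<Theta>: "young_function \<Theta>" and dom: "dominated_globally (\<Phi>s \<circ> half_inv \<Psi>s) \<Theta>"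
      and delta: "delta_prime \<Phi>s" and nabla: "nabla_prime \<Theta>"
      and B: "AE x in M. x \<in> B \<longrightarrow> E\<Phi>u x = 0"
      and sup: "(SUP n\<in>I. atom_value M E\<Phi>u (A n) * emeasure M (A n) / ennreal (\<Phi>s (half_inv \<Psi>s (measure M (A n))))) < \<infinity>"
    for \<Theta>
  proof -
    obtain a where a: "0 \<le> a" "\<And>x. 0 \<le> x \<Longrightarrow> \<theta> x \<le> \<Theta> (a * x)"
      using dom unfolding dominated_globally_def \<theta>_def by auto
    obtain b where b: "0 < b" "\<And>x y. 0 \<le> x \<Longrightarrow> 0 \<le> y \<Longrightarrow> \<Theta> x * \<Theta> y \<le> \<Theta> (b * x * y)"
      using nabla unfolding nabla_prime_def by blast
    obtain C where C: "0 \<le> C" "(SUP n\<in>I. atom_value M E\<Phi>u (A n) * emeasure M (A n) / ennreal (\<theta> (p n))) = ennreal C"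
      using sup unfolding \<theta>_def p_def by (cases rule: ennreal_cases) auto
    show ?thesis
    \<comment> \<open>Domination puts a factor \<open>a\<close> on each of the arguments
      \<open>p n\<close> and \<open>\<Psi>s y\<close>; merging the two values of
      \<open>\<Theta>\<close> contributes \<open>b\<close>.\<close>
    proof (rule bounded[OF delta B \<Theta> _ C(1), of "b * a * a"])
      show "0 \<le> b * a * a" using a b by simp
      fix n and y :: real assume n: "n \<in> I" and y: "0 \<le> y"
      have \<theta>p: "0 < \<theta> (p n)" by (rule \<theta>_pos[OF p[OF n]])
      have "(\<integral>\<^sup>+x\<in>A n. w x \<partial>M) / ennreal (\<theta> (p n)) \<le> ennreal C"
        using SUP_upper[OF n, of "\<lambda>n. atom_value M E\<Phi>u (A n) * emeasure M (A n) / ennreal (\<theta> (p n))"] C(2) n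
        by (simp add: atom)
      then have "(\<integral>\<^sup>+x\<in>A n. w x \<partial>M) / ennreal (\<theta> (p n)) * ennreal (\<theta> (p n)) \<le> ennreal C * ennreal (\<theta> (p n))"
        by (rule mult_right_mono) simp
      then have "(\<integral>\<^sup>+x\<in>A n. w x \<partial>M) \<le> ennreal C * ennreal (\<theta> (p n))"
        using \<theta>p by (simp add: ennreal_divide_times ennreal_mult_divide_eq)
      then have "(\<integral>\<^sup>+x\<in>A n. w x \<partial>M) * ennreal (\<Phi>s y) \<le> ennreal C * ennreal (\<theta> (p n)) * ennreal (\<theta> (\<Psi>s y))"
        unfolding \<theta>_\<Psi>s[OF y] by (rule mult_right_mono) simp
      also have "\<dots> = ennreal (C * (\<theta> (p n) * \<theta> (\<Psi>s y)))"
        using C(1) \<theta>_nonneg by (simp add: ennreal_mult mult.assoc)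
      also have "\<dots> \<le> ennreal (C * \<Theta> (\<Psi>s y * p n * (b * a * a)))"
      proof (intro ennreal_leI mult_left_mono C(1))
        have "\<theta> (p n) * \<theta> (\<Psi>s y) \<le> \<Theta> (a * p n) * \<Theta> (a * \<Psi>s y)"
          using a \<theta>_nonneg \<Psi>s_nonneg p[OF n] young_nonneg[OF \<Theta>] by (intro mult_mono a) auto
        also have "\<dots> \<le> \<Theta> (b * (a * p n) * (a * \<Psi>s y))"
          using a(1) \<Psi>s_nonneg p[OF n] by (intro b) auto
        also have "b * (a * p n) * (a * \<Psi>s y) = \<Psi>s y * p n * (b * a * a)" by (simp add: mult_ac)
        finally show "\<theta> (p n) * \<theta> (\<Psi>s y) \<le> \<Theta> (\<Psi>s y * p n * (b * a * a))" .
      qed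
      finally show "(\<integral>\<^sup>+x\<in>A n. w x \<partial>M) * ennreal (\<Phi>s y) \<le> ennreal (C * \<Theta> (\<Psi>s y * p n * (b * a * a)))" .
    qed
  qed

  have part_a': "wct_bounded M \<A> \<Phi> \<Psi> u D"
    if \<Theta>: "young_function \<Theta>" and dom: "dominated_globally (\<Phi>s \<circ> half_inv \<Psi>s) \<Theta>"
      and delta: "delta_prime \<Phi>s" and delta': "delta_prime (half_inv \<Psi>s)"
      and sup: "(SUP n\<in>I. atom_value M E\<Phi>u (A n) * emeasure M (A n) * ennreal (\<Phi>s (half_inv \<Psi>s (1 / measure M (A n))))) < \<infinity>"
      and B: "AE x in M. x \<in> B \<longrightarrow> E\<Phi>u x = 0"
    for \<Theta>
  proof -
    obtain a where a: "0 \<le> a" "\<And>x. 0 \<le> x \<Longrightarrow> \<theta> x \<le> \<Theta> (a * x)"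
      using dom unfolding dominated_globally_def \<theta>_def by auto
    obtain c where c: "0 < c" "\<And>x y. 0 \<le> x \<Longrightarrow> 0 \<le> y \<Longrightarrow> \<Phi>s (x * y) \<le> c * \<Phi>s x * \<Phi>s y"
      using delta unfolding delta_prime_def by blast
    obtain d where d: "0 < d" "\<And>x y. 0 \<le> x \<Longrightarrow> 0 \<le> y \<Longrightarrow> half_inv \<Psi>s (x * y) \<le> d * half_inv \<Psi>s x * half_inv \<Psi>s y"
      using delta' unfolding delta_prime_def by blast
    \<comment> \<open>Submultiplicativity of the inverse followed by two uses of that of
      \<open>\<Phi>s\<close>, one to split off the constant \<open>d\<close> and one to separate the
      factors.\<close>
    have \<theta>_mult: "\<theta> (x * y) \<le> c * c * \<Phi>s d * (\<theta> x * \<theta> y)" if "0 \<le> x" "0 \<le> y" for x y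
    proof -
      have nn: "0 \<le> half_inv \<Psi>s x" "0 \<le> half_inv \<Psi>s y" "0 \<le> half_inv \<Psi>s (x * y)"
        using that by (simp_all add: \<Psi>s_def half_inv_nonneg[OF \<psi>])
      have "\<theta> (x * y) \<le> \<Phi>s (d * (half_inv \<Psi>s x * half_inv \<Psi>s y))"
        unfolding \<theta>_def \<Phi>s_def using d(2)[OF that] nn by (intro young_mono[OF \<phi>]) (simp_all add: mult.assoc)
      also have "\<dots> \<le> c * \<Phi>s d * \<Phi>s (half_inv \<Psi>s x * half_inv \<Psi>s y)"
        using d(1) nn by (intro c) auto
      also have "\<dots> \<le> c * \<Phi>s d * (c * \<Phi>s (half_inv \<Psi>s x) * \<Phi>s (half_inv \<Psi>s y))"
        using c(1) young_nonneg[OF \<phi>] nn by (intro mult_left_mono c) (auto simp: \<Phi>s_def)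
      finally show ?thesis by (simp add: \<theta>_def mult_ac)
    qed
    obtain C where C: "0 \<le> C" "(SUP n\<in>I. atom_value M E\<Phi>u (A n) * emeasure M (A n) * ennreal (\<theta> (1 / p n))) = ennreal C"
      using sup unfolding \<theta>_def p_def by (cases rule: ennreal_cases) auto
    have \<Phi>sd: "0 \<le> c * c * \<Phi>s d" using c(1) young_nonneg[OF \<phi>] by (simp add: \<Phi>s_def)
    show ?thesis
    proof (rule bounded[OF delta B \<Theta> a(1), of "c * c * \<Phi>s d * C"])
      show "0 \<le> c * c * \<Phi>s d * C" using \<Phi>sd C(1) by simp
      fix n and y :: real assume n: "n \<in> I" and y: "0 \<le> y"
      have le: "(\<integral>\<^sup>+x\<in>A n. w x \<partial>M) * ennreal (\<theta> (1 / p n)) \<le> ennreal C"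
        using SUP_upper[OF n, of "\<lambda>n. atom_value M E\<Phi>u (A n) * emeasure M (A n) * ennreal (\<theta> (1 / p n))"] C(2) n
        by (simp add: atom)
      \<comment> \<open>Splitting off \<open>1 / p n\<close> matches the supremum in the hypothesis.
        Only the other factor is then dominated by \<open>\<Theta>\<close>, whose convexity the
        summation over atoms needs.\<close>
      have "\<Phi>s y = \<theta> (1 / p n * (p n * \<Psi>s y))"
        using p[OF n] by (simp add: \<theta>_\<Psi>s[OF y])
      also have "\<dots> \<le> c * c * \<Phi>s d * (\<theta> (1 / p n) * \<theta> (p n * \<Psi>s y))"
        using p[OF n] \<Psi>s_nonneg by (intro \<theta>_mult) auto
      also have "\<dots> \<le> c * c * \<Phi>s d * (\<theta> (1 / p n) * \<Theta> (a * (p n * \<Psi>s y)))"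
        using p[OF n] \<Psi>s_nonneg \<Phi>sd \<theta>_nonneg by (intro mult_left_mono a) auto
      finally have "ennreal (\<Phi>s y) \<le> ennreal (\<theta> (1 / p n) * (c * c * \<Phi>s d * \<Theta> (\<Psi>s y * p n * a)))"
        by (intro ennreal_leI) (simp add: mult_ac)
      also have "\<dots> = ennreal (\<theta> (1 / p n)) * ennreal (c * c * \<Phi>s d * \<Theta> (\<Psi>s y * p n * a))"
        using \<theta>_nonneg by (intro ennreal_mult') 
      finally have "(\<integral>\<^sup>+x\<in>A n. w x \<partial>M) * ennreal (\<Phi>s y)
          \<le> (\<integral>\<^sup>+x\<in>A n. w x \<partial>M) * (ennreal (\<theta> (1 / p n)) * ennreal (c * c * \<Phi>s d * \<Theta> (\<Psi>s y * p n * a)))"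
        by (rule mult_left_mono) simp
      also have "\<dots> \<le> ennreal C * ennreal (c * c * \<Phi>s d * \<Theta> (\<Psi>s y * p n * a))"
        unfolding mult.assoc[symmetric, of _ "ennreal (\<theta> (1 / p n))"] by (intro mult_right_mono le) simp
      also have "\<dots> = ennreal (c * c * \<Phi>s d * C * \<Theta> (\<Psi>s y * p n * a))"
        using C(1) by (simp add: ennreal_mult'[symmetric] mult_ac)
      finally show "(\<integral>\<^sup>+x\<in>A n. w x \<partial>M) * ennreal (\<Phi>s y) \<le> ennreal (c * c * \<Phi>s d * C * \<Theta> (\<Psi>s y * p n * a))" .
    qed
  qed

  have part_b: "(AE x in M. x \<in> B \<longrightarrow> E\<Phi>u x = 0) \<and>
      (SUP n\<in>I. atom_value M E\<Phi>u (A n) * emeasure M (A n) * ennreal (\<Phi>s (half_inv \<Psi>s (1 / measure M (A n))))) < \<infinity>"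
    if ext: "young_function (even_extension (\<Phi>s \<circ> half_inv \<Psi>s))" and nabla: "nabla_prime \<Phi>s"
      and wd: "wct_well_defined M \<A> \<Psi> u (orlicz_space M \<Phi>)"
      and bd: "wct_bounded M \<A> \<Phi> \<Psi> u (orlicz_space M \<Phi>)"
  proof -
    obtain C where C: "0 < C" "\<And>A m. A \<in> sets \<A> \<Longrightarrow> emeasure M A = ennreal m \<Longrightarrow> 0 < m \<Longrightarrow>
        (\<integral>\<^sup>+x\<in>A. w x \<partial>M) * ennreal (\<theta> (1 / m)) \<le> ennreal C"
      using wct_bounded_imp_set_modular_bound[OF \<Phi> \<phi> \<Psi> \<psi> u wd bd] nabla
      unfolding w_def \<theta>_def \<Phi>s_def \<Psi>s_def by blast
    have "\<theta> = \<Phi>s \<circ> half_inv \<Psi>s" by (simp add: \<theta>_def fun_eq_iff)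
    then have "AE x in M. x \<in> B \<longrightarrow> E\<Phi>u x = 0"
      unfolding E using ext by (intro nonatomic_AE_zero[where \<theta>=\<theta> and w=w, OF Dec(5) _ _ C]) simp_all
    moreover have "(SUP n\<in>I. atom_value M E\<Phi>u (A n) * emeasure M (A n) * ennreal (\<Phi>s (half_inv \<Psi>s (1 / measure M (A n))))) \<le> ennreal C"
    proof (rule SUP_least)
      fix n assume n: "n \<in> I"
      show "atom_value M E\<Phi>u (A n) * emeasure M (A n) * ennreal (\<Phi>s (half_inv \<Psi>s (1 / measure M (A n)))) \<le> ennreal C"
        using C(2)[OF Dec(2)[OF n] atom_meas[OF n]] unfolding atom[OF n] \<theta>_def .
    qed
    ultimately show ?thesis by (auto simp: le_less_trans)
  qed
  show ?thesis
    using part_a part_a' part_b by blast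
qed

end
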